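(* Let $R>0$, $0<\lambda,\Lambda<\infty$, $\lambda_q\ge0$, and let $P$ and $\psi$ be the constant and function determined by $R,\lambda,\lambda_q$ in the context. Let $V\in C^\infty(\mathbb{R}^n)$ satisfy $e^{-V(x)}\,dx\in\mathcal{P}(\mathbb{R}^n)$, $V(0)=\inf_{\mathbb{R}^n}V$, and $\lambda\,\mathrm{Id}\le D^2V\le\Lambda\,\mathrm{Id}$ on $\mathbb{R}^n$. Let $q\in C^\infty_c(B_R)$ with $D^2q\ge-\lambda_q\,\mathrm{Id}$ and let $c_q\in\mathbb{R}$ be such that $e^{-V(x)+c_q-q(x)}\,dx\in\mathcal{P}(\mathbb{R}^n)$. Given $j>P$, set $V^j:=V$ in $B_j$ and $V^j:=\infty$ in $\mathbb{R}^n\setminus B_j$, and choose $c_{q,j}\in(0,\infty)$ such that $e^{c_{q,j}-V^j(x)+c_q-q(x)}\,dx\in\mathcal{P}(\mathbb{R}^n)$ (for $j=\infty$: $V^\infty=V$ and $c_{q,\infty}=0$). Let $\phi=\phi_j\in C^\infty(\mathbb{R}^n)$ be a convex solution of $$\det D^2\phi=\frac{e^{-V}}{e^{c_{q,j}-V^j(\nabla\phi)+c_q-q(\nabla\phi)}}\quad\text{in }\mathbb{R}^n,$$ where $\nabla\phi$ takes values in $B_j$. Assume that there exist constants $j',P'>0$ such that for all $j\in[j',\infty]$ (with $j>P$) $$\nabla\phi_j(\mathbb{R}^n\setminus B_{P'})\subseteq\mathbb{R}^n\setminus B_P,$$ or equivalently $[\nabla\phi_j]^{-1}(B_P)\subseteq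 B_{P'}$. For such $j$ and $\phi=\phi_j$ define, for $(x,\alpha)\in\mathbb{R}^n\times\mathbb{S}^{n-1}$, $$h(x,\alpha):=\phi_{\alpha\alpha}(x)\,e^{\psi(\nabla\phi(x))}.$$ If $h$ attains a maximum at some point $(x_0,\alpha_0)$ among all possible $(x,\alpha)\in\mathbb{R}^n\times\mathbb{S}^{n-1}$, then there exists a constant $C=C(R,P',\lambda,\Lambda,\lambda_q)>0$, independent of $n$, such that $$h(x_0,\alpha_0)\le C.$$
   Context: $\mathcal{P}(\mathbb{R}^n)$ is the set of Borel probability measures on $\mathbb{R}^n$; $B_r\subset\mathbb{R}^n$ is the ball of radius $r$ centered at the origin ($B_\infty=\mathbb{R}^n$); $\mathbb{S}^{n-1}$ is the unit sphere; $\phi_{\alpha\alpha}(x)=\langle D^2\phi(x)\alpha,\alpha\rangle$. The constants $P$, $Q$ and the function $\psi$ are defined from $R,\lambda,\lambda_q$ by $$P:=\frac{2\lambda_q+4\lambda_qR}{\lambda}+1+R,\qquad Q:=\frac{\lambda}{2\lambda_q}+1+R,$$ $$\overline\psi(t):=\int_0^t\int_0^s\vartheta(r)\,dr\,ds\quad(t\ge0),$$ $$\vartheta(r):=\begin{cases}\lambda_q & r\in[0,R]\\ -\lambda_qr+\lambda_q+\lambda_qR & r\in[R,Q]\\ \dfrac{\lambda_q\lambda^2r}{4\lambda_q^2+8\lambda_q^2R-\lambda^2}-\dfrac{2\lambda_q^2\lambda+4\lambda_q^2\lambda R+\lambda_q\lambda^2+\lambda_q\lambda^2R}{4\lambda_q^2+8\lambda_q^2R-\lambda^2}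 & r\in[Q,P]\\ 0 & r\in[P,\infty),\end{cases}$$ with $\overline\psi=0$ (and $P=1+R$) if $\lambda_q=0$; and $\psi\in C^2(\mathbb{R}^n)$ is $\psi(y):=\overline\psi(|y|)$. The function $\overline\psi$ is defined in such a way that $\overline\psi\in C^2([0,\infty))$, $\overline\psi''\ge-\lambda/2$ on $[0,\infty)$, $\overline\psi(t)=\lambda_qt^2/2$ on $[0,R]$, and $\overline\psi'=0$ on $[P,\infty)$.
   Formalization: The formal theorem additionally assumes λ_q = 0 or Q < P (equivalently λ² < 4λ_q²(1+2R)); for λ_q > 0 and P ≤ Q the displayed formulas for ϑ contradict each other, so ψ is undefined there. *)

theory Defs
  imports "HOL-Analysis.Analysis" "HOL-Probability.Probability" "Jordan_Normal_Form.Determinant"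
begin

text \<open>
  The bound to be stated is uniform in the dimension, so the dimension has to be a natural number
  that can be quantified inside a formula, and cannot be a type. Euclidean n-space is the set of
  functions from \<open>{..<n}\<close> to the reals, extended by \<open>undefined\<close>. This is the carrier of the product
  measure space \<open>PiM {..<n}\<close>; the product topology restricted to it is the Euclidean topology.
  Functions on n-space are total functions on \<open>nat \<Rightarrow> real\<close>, and only their values on this carrier
  are ever used.
\<close>

definition Rn :: "nat \<Rightarrow> (nat \<Rightarrow> real) set" where
  "Rn n = ({..<n} \<rightarrow>\<^sub>E UNIV)"

definition lebesgue_Rn :: "nat \<Rightarrow> (nat \<Rightarrow> real) measure" where
  "lebesgue_Rn n = PiM {..<n} (\<lambda>_. lborel)"

definition origin_Rn :: "nat \<Rightarrow> nat \<Rightarrow> real" where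
  "origin_Rn n = (\<lambda>i\<in>{..<n}. 0)"

definition norm_Rn :: "nat \<Rightarrow> (nat \<Rightarrow> real) \<Rightarrow> real" where
  "norm_Rn n x = L2_set x {..<n}"

text \<open>The radius is extended real, so that the ball of radius \<open>\<infinity>\<close> is the whole space.\<close>

definition ball_Rn :: "nat \<Rightarrow> ereal \<Rightarrow> (nat \<Rightarrow> real) set" where
  "ball_Rn n r = {x \<in> Rn n. ereal (norm_Rn n x) < r}"

definition sphere_Rn :: "nat \<Rightarrow> (nat \<Rightarrow> real) set" where
  "sphere_Rn n = {x \<in> Rn n. norm_Rn n x = 1}"

definition convex_fun_Rn :: "nat \<Rightarrow> ((nat \<Rightarrow> real) \<Rightarrow> real) \<Rightarrow> bool" where
  "convex_fun_Rn n f \<longleftrightarrow> (\<forall>x\<in>Rn n. \<forall>y\<in>Rn n. \<forall>t\<in>{0..1}.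
     f (\<lambda>i\<in>{..<n}. (1 - t) * x i + t * y i) \<le> (1 - t) * f x + t * f y)"

definition partial :: "nat \<Rightarrow> ((nat \<Rightarrow> real) \<Rightarrow> real) \<Rightarrow> (nat \<Rightarrow> real) \<Rightarrow> real" where
  "partial i f x = deriv (\<lambda>t. f (x(i := t))) (x i)"

text \<open>Smoothness: all iterated partial derivatives exist and are continuous.\<close>

definition smooth_Rn :: "nat \<Rightarrow> ((nat \<Rightarrow> real) \<Rightarrow> real) \<Rightarrow> bool" where
  "smooth_Rn n f \<longleftrightarrow> (\<forall>is. set is \<subseteq> {..<n} \<longrightarrow>
     continuous_on (Rn n) (foldr partial is f) \<and>
     (\<forall>i<n. \<forall>x\<in>Rn n. (\<lambda>t. foldr partial is f (x(i := t))) differentiable at (x i)))"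

definition smooth_compact_support_in ::
  "nat \<Rightarrow> (nat \<Rightarrow> real) set \<Rightarrow> ((nat \<Rightarrow> real) \<Rightarrow> real) \<Rightarrow> bool" where
  "smooth_compact_support_in n U f \<longleftrightarrow> smooth_Rn n f \<and>
     compact (closure {x \<in> Rn n. f x \<noteq> 0}) \<and> closure {x \<in> Rn n. f x \<noteq> 0} \<subseteq> U"

definition grad :: "nat \<Rightarrow> ((nat \<Rightarrow> real) \<Rightarrow> real) \<Rightarrow> (nat \<Rightarrow> real) \<Rightarrow> nat \<Rightarrow> real" where
  "grad n f x = (\<lambda>i\<in>{..<n}. partial i f x)"

definition hessian :: "nat \<Rightarrow> ((nat \<Rightarrow> real) \<Rightarrow> real) \<Rightarrow> (nat \<Rightarrow> real) \<Rightarrow> real mat" where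
  "hessian n f x = Matrix.mat n n (\<lambda>(i, j). partial i (partial j f) x)"

definition hessian_form ::
  "nat \<Rightarrow> ((nat \<Rightarrow> real) \<Rightarrow> real) \<Rightarrow> (nat \<Rightarrow> real) \<Rightarrow> (nat \<Rightarrow> real) \<Rightarrow> real" where
  "hessian_form n f x \<alpha> = (\<Sum>i<n. \<Sum>j<n. hessian n f x $$ (i, j) * \<alpha> j * \<alpha> i)"

definition hessian_ge :: "nat \<Rightarrow> real \<Rightarrow> ((nat \<Rightarrow> real) \<Rightarrow> real) \<Rightarrow> bool" where
  "hessian_ge n c f \<longleftrightarrow>
     (\<forall>x\<in>Rn n. \<forall>\<xi>\<in>Rn n. c * (norm_Rn n \<xi>)\<^sup>2 \<le> hessian_form n f x \<xi>)"

definition hessian_le :: "nat \<Rightarrow> real \<Rightarrow> ((nat \<Rightarrow> real) \<Rightarrow> real) \<Rightarrow> bool" where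
  "hessian_le n c f \<longleftrightarrow>
     (\<forall>x\<in>Rn n. \<forall>\<xi>\<in>Rn n. hessian_form n f x \<xi> \<le> c * (norm_Rn n \<xi>)\<^sup>2)"

text \<open>
  Exponential on the extended reals, needed for densities whose potential is \<open>\<infinity>\<close> outside a ball.
  It is only applied to exponents below \<open>\<infinity>\<close>; its value at \<open>\<infinity>\<close> is irrelevant.
\<close>

definition exp_ereal :: "ereal \<Rightarrow> real" where
  "exp_ereal a = (if a = -\<infinity> then 0 else exp (real_of_ereal a))"

definition has_prob_density :: "nat \<Rightarrow> ((nat \<Rightarrow> real) \<Rightarrow> real) \<Rightarrow> bool" where
  "has_prob_density n f \<longleftrightarrow> prob_space (density (lebesgue_Rn n) (\<lambda>x. ennreal (f x)))"

definition V_trunc ::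
  "nat \<Rightarrow> ((nat \<Rightarrow> real) \<Rightarrow> real) \<Rightarrow> ereal \<Rightarrow> (nat \<Rightarrow> real) \<Rightarrow> ereal" where
  "V_trunc n V j x = (if x \<in> ball_Rn n j then ereal (V x) else \<infinity>)"

definition target_density ::
  "nat \<Rightarrow> ((nat \<Rightarrow> real) \<Rightarrow> real) \<Rightarrow> ((nat \<Rightarrow> real) \<Rightarrow> real) \<Rightarrow> real \<Rightarrow> real \<Rightarrow> ereal \<Rightarrow>
   (nat \<Rightarrow> real) \<Rightarrow> real" where
  "target_density n V q c_q c_qj j y =
     exp_ereal (ereal c_qj - V_trunc n V j y + ereal c_q - ereal (q y))"

text \<open>From here on \<open>l\<close> and \<open>lq\<close> stand for \<open>\<lambda>\<close> and \<open>\<lambda>\<^sub>q\<close>.\<close>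

definition const_P :: "real \<Rightarrow> real \<Rightarrow> real \<Rightarrow> real" where
  "const_P R l lq = (2 * lq + 4 * lq * R) / l + 1 + R"

definition const_Q :: "real \<Rightarrow> real \<Rightarrow> real \<Rightarrow> real" where
  "const_Q R l lq = l / (2 * lq) + 1 + R"

text \<open>
  The four formulas below are prescribed on the closed intervals between \<open>0 < R < Q < P\<close>. For
  \<open>lq > 0\<close> this presupposes \<open>Q < P\<close>, which says exactly that the denominator
  \<open>4 lq\<^sup>2 + 8 lq\<^sup>2 R - l\<^sup>2\<close> is positive. If \<open>P \<le> Q\<close>, then the second and the fourth formula
  contradict each other on \<open>[P, Q]\<close>, and there is no such function.
\<close>

definition theta :: "real \<Rightarrow> real \<Rightarrow> real \<Rightarrow> real \<Rightarrow> real" where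
  "theta R l lq r =
     (if r \<le> R then lq
      else if r \<le> const_Q R l lq then - lq * r + lq + lq * R
      else if r \<le> const_P R l lq then
        lq * l\<^sup>2 * r / (4 * lq\<^sup>2 + 8 * lq\<^sup>2 * R - l\<^sup>2)
        - (2 * lq\<^sup>2 * l + 4 * lq\<^sup>2 * l * R + lq * l\<^sup>2 + lq * l\<^sup>2 * R)
            / (4 * lq\<^sup>2 + 8 * lq\<^sup>2 * R - l\<^sup>2)
      else 0)"

definition theta_well_defined :: "real \<Rightarrow> real \<Rightarrow> real \<Rightarrow> bool" where
  "theta_well_defined R l lq \<longleftrightarrow> lq = 0 \<or> const_Q R l lq < const_P R l lq"

definition psi_bar :: "real \<Rightarrow> real \<Rightarrow> real \<Rightarrow> real \<Rightarrow> real" where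
  "psi_bar R l lq t =
     (if lq = 0 then 0 else integral {0..t} (\<lambda>s. integral {0..s} (theta R l lq)))"

definition psi :: "real \<Rightarrow> real \<Rightarrow> real \<Rightarrow> nat \<Rightarrow> (nat \<Rightarrow> real) \<Rightarrow> real" where
  "psi R l lq n y = psi_bar R l lq (norm_Rn n y)"

definition h_fun ::
  "real \<Rightarrow> real \<Rightarrow> real \<Rightarrow> nat \<Rightarrow> ((nat \<Rightarrow> real) \<Rightarrow> real) \<Rightarrow> (nat \<Rightarrow> real) \<Rightarrow> (nat \<Rightarrow> real) \<Rightarrow> real" where
  "h_fun R l lq n \<phi> x \<alpha> = hessian_form n \<phi> x \<alpha> * exp (psi R l lq n (grad n \<phi> x))"

end

theory Submission
  imports Defs
begin

text \<open>
  The proof is Pogorelov's maximum principle. Below, \<open>\<lambda>\<close>, \<open>\<Lambda>\<close> and \<open>\<lambda>\<^sub>q\<close> are written \<open>l\<close>, \<open>L\<close> and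
  \<open>lq\<close>. Put \<open>W = V + q\<close>, so that the equation reads
  \<open>ln det D\<^sup>2\<phi> = - V + W(\<nabla>\<phi>) - c\<close>. Let \<open>A = D\<^sup>2\<phi>(x\<^sub>0)\<close>, \<open>y\<^sub>0 = \<nabla>\<phi>(x\<^sub>0)\<close>, \<open>p = \<nabla>\<psi>(y\<^sub>0)\<close> and
  \<open>M = \<phi>\<^sub>\<alpha>\<^sub>\<alpha>(x\<^sub>0)\<close> for the maximising direction \<open>\<alpha>\<close>, and complete \<open>u = \<alpha>/\<surd>M\<close> to a basis
  \<open>v\<^sub>0 = u, v\<^sub>1, \<dots>\<close> that is orthonormal for the inner product \<open>A\<close>; summing second derivatives over
  this basis is contracting with the inverse of \<open>A\<close>. The function \<open>ln \<phi>\<^sub>u\<^sub>u + \<psi>(\<nabla>\<phi>)\<close> is maximal at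
  \<open>x\<^sub>0\<close>. Its first-order condition, its second-order conditions along the \<open>v\<^sub>i\<close>, the derivative of
  the equation along \<open>p\<close> and its second derivative along \<open>u\<close> combine to
  \<open>- D\<^sup>2V(x\<^sub>0)(u,u) + D\<^sup>2W(y\<^sub>0)(Au,Au) + \<Sum>\<^sub>i D\<^sup>2\<psi>(y\<^sub>0)(Av\<^sub>i,Av\<^sub>i) \<le> \<langle>\<nabla>V(x\<^sub>0), p\<rangle>\<close>:
  the third derivatives of \<open>\<phi>\<close> either cancel or have a good sign. This is \<open>maximum_inequality\<close>.

  The weight is built for this inequality. If \<open>|y\<^sub>0| < R\<close>, then \<open>D\<^sup>2\<psi> = \<lambda>\<^sub>q Id\<close>, and the term \<open>i = 0\<close> of
  the sum compensates the concavity of \<open>q\<close>. If \<open>|y\<^sub>0| \<ge> R\<close>, then \<open>q\<close> vanishes near \<open>y\<^sub>0\<close>, and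
  \<open>D\<^sup>2\<psi> \<ge> - \<lambda>/2\<close> in the radial direction costs at most \<open>\<lambda>M/2\<close>, because \<open>M\<close> is the largest value of
  \<open>A\<close> on the sphere. Since \<open>|Au|\<^sup>2 \<ge> M\<close> and \<open>D\<^sup>2V(u,u) \<le> \<Lambda>/M\<close>, both cases give
  \<open>\<lambda>M/2 \<le> \<Lambda>/M + \<langle>\<nabla>V(x\<^sub>0), p\<rangle>\<close>. Finally \<open>p = 0\<close> if \<open>|y\<^sub>0| \<ge> P\<close>; otherwise \<open>|x\<^sub>0| \<le> P'\<close>, and both
  \<open>\<nabla>V(x\<^sub>0)\<close> and \<open>p\<close> are bounded independently of the dimension.

  Two devices keep the calculus one-dimensional. The derivatives of \<open>ln det D\<^sup>2\<phi>\<close> are not computed: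
  Hadamard's inequality bounds it above along a line by a sum of logarithms of values of the Hessian
  form, with equality at \<open>x\<^sub>0\<close>, and comparing derivatives at the point of contact gives what is
  needed (\<open>log_det_comparison\<close>). Likewise \<open>\<psi>\<close> is never differentiated on n-space: along each line it
  is replaced by a smooth function that touches it from below at \<open>x\<^sub>0\<close>, which preserves the
  maximum (\<open>maximum_with_touching_function\<close>).
\<close>

section \<open>Smooth functions on n-space\<close>

lemma Rn_upd: "x \<in> Rn n \<Longrightarrow> i < n \<Longrightarrow> x(i := t) \<in> Rn n"
  by (auto simp: Rn_def PiE_def extensional_def)

lemma Rn_eqI: "x \<in> Rn n \<Longrightarrow> y \<in> Rn n \<Longrightarrow> (\<And>i. i < n \<Longrightarrow> x i = y i) \<Longrightarrow> x = y"
  unfolding Rn_def by (rule PiE_ext) auto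

lemma restrict_Rn [simp]: "(\<lambda>i\<in>{..<n}. c i) \<in> Rn n"
  by (auto simp: Rn_def)

lemma smooth_partial: "smooth_Rn n f \<Longrightarrow> i < n \<Longrightarrow> smooth_Rn n (partial i f)"
  unfolding smooth_Rn_def
proof (intro allI impI)
  fix ks assume f: "\<forall>ks. set ks \<subseteq> {..<n} \<longrightarrow>
     continuous_on (Rn n) (foldr partial ks f) \<and>
     (\<forall>i<n. \<forall>x\<in>Rn n. (\<lambda>t. foldr partial ks f (x(i := t))) differentiable at (x i))"
    and i: "i < n" and "set ks \<subseteq> {..<n}"
  then have "set (ks @ [i]) \<subseteq> {..<n}" by auto
  with f have "continuous_on (Rn n) (foldr partial (ks @ [i]) f) \<and>
     (\<forall>k<n. \<forall>x\<in>Rn n. (\<lambda>t. foldr partial (ks @ [i]) f (x(k := t))) differentiable at (x k))" by blast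
  then show "continuous_on (Rn n) (foldr partial ks (partial i f)) \<and>
     (\<forall>k<n. \<forall>x\<in>Rn n. (\<lambda>t. foldr partial ks (partial i f) (x(k := t))) differentiable at (x k))" by simp
qed

lemma smooth_continuous: "smooth_Rn n f \<Longrightarrow> continuous_on (Rn n) f"
  unfolding smooth_Rn_def by (drule spec[of _ "[]"]) simp

lemma smooth_DERIV_coord:
  assumes f: "smooth_Rn n f" and i: "i < n" and x: "x \<in> Rn n"
  shows "((\<lambda>t. f (x(i := t))) has_real_derivative partial i f (x(i := s))) (at s)"
proof -
  have "(\<lambda>t. f ((x(i := s))(i := t))) differentiable at ((x(i := s)) i)"
    using f i Rn_upd[OF x i, of s] unfolding smooth_Rn_def by (metis empty_set foldr_Nil id_apply empty_subsetI)
  then have "(\<lambda>t. f (x(i := t))) differentiable at s" by simp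
  then show ?thesis
    unfolding partial_def by (simp add: DERIV_deriv_iff_real_differentiable)
qed

lemma MVT_between:
  fixes g g' :: "real \<Rightarrow> real"
  assumes "\<And>s. (g has_real_derivative g' s) (at s)"
  obtains s where "\<bar>s - a\<bar> \<le> \<bar>b - a\<bar>" "g b - g a = g' s * (b - a)"
proof (cases a b rule: linorder_cases)
  case less
  obtain z where "z > a" "z < b" "g b - g a = (b - a) * g' z" using MVT2[OF less assms] by blast
  then show thesis using that[of z] by (simp add: mult.commute)
next
  case equal then show thesis using that[of a] by simp
next
  case greater
  obtain z where "z > b" "z < a" "g a - g b = (a - b) * g' z" using MVT2[OF greater assms] by blast
  then show thesis using that[of z] by (simp add: algebra_simps)
qed

text \<open>
  Points of n-space are \<open>undefined\<close> beyond the first n coordinates, so these coordinates converge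
  trivially in the product topology.
\<close>

lemma tendsto_Rn:
  fixes g :: "'a \<Rightarrow> nat \<Rightarrow> real"
  assumes "\<And>t. g t \<in> Rn n" and "x \<in> Rn n" and "\<And>i. i < n \<Longrightarrow> ((\<lambda>t. g t i) \<longlongrightarrow> x i) F"
  shows "(g \<longlongrightarrow> x) F"
proof -
  have "((\<lambda>t. g t i) \<longlongrightarrow> x i) F" for i
  proof (cases "i < n")
    case False
    then have "g t i = undefined" "x i = undefined" for t
      using assms(1)[of t] assms(2) by (auto simp: Rn_def PiE_def extensional_def)
    then show ?thesis by simp
  qed (simp add: assms)
  then have "limitin (product_topology (\<lambda>i. euclidean) UNIV) g x F"
    by (simp add: limitin_componentwise extensional_def)
  then show ?thesis by (simp add: euclidean_product_topology)
qed

text \<open>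
  Change one coordinate at a time and apply the mean value theorem to each change.
\<close>

lemma increment_coordinates:
  assumes f: "smooth_Rn n f" and x: "x \<in> Rn n" and y: "y \<in> Rn n"
  shows "\<exists>\<xi>. (\<forall>i<n. \<xi> i \<in> Rn n \<and> (\<forall>k<n. \<bar>\<xi> i k - x k\<bar> \<le> \<bar>y k - x k\<bar>)) \<and>
           f y - f x = (\<Sum>i<n. partial i f (\<xi> i) * (y i - x i))"
proof -
  define z where "z k = (\<lambda>i. if i < k then y i else x i)" for k
  have zR: "z k \<in> Rn n" for k using x y by (auto simp: z_def Rn_def PiE_def extensional_def)
  have z0: "z 0 = x" by (simp add: z_def)
  have zn: "z n = y" by (rule Rn_eqI[OF zR y]) (simp add: z_def)
  have "\<exists>\<xi>. \<xi> \<in> Rn n \<and> (\<forall>k<n. \<bar>\<xi> k - x k\<bar> \<le> \<bar>y k - x k\<bar>) \<and>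
      f (z (Suc i)) - f (z i) = partial i f \<xi> * (y i - x i)" if i: "i < n" for i
  proof -
    obtain s where s: "\<bar>s - x i\<bar> \<le> \<bar>y i - x i\<bar>"
      "f ((z i)(i := y i)) - f ((z i)(i := x i)) = partial i f ((z i)(i := s)) * (y i - x i)"
      by (rule MVT_between[of "\<lambda>t. f ((z i)(i := t))" "\<lambda>s. partial i f ((z i)(i := s))" "x i" "y i",
          OF smooth_DERIV_coord[OF f i zR]])
    have e: "(z i)(i := y i) = z (Suc i)" "(z i)(i := x i) = z i" by (auto simp: z_def)
    have "\<forall>k<n. \<bar>((z i)(i := s)) k - x k\<bar> \<le> \<bar>y k - x k\<bar>" using s(1) by (auto simp: z_def)
    then show ?thesis using s(2) Rn_upd[OF zR i, of i s] unfolding e by blast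
  qed
  then obtain \<xi> where \<xi>: "\<And>i. i < n \<Longrightarrow> \<xi> i \<in> Rn n \<and> (\<forall>k<n. \<bar>\<xi> i k - x k\<bar> \<le> \<bar>y k - x k\<bar>) \<and>
      f (z (Suc i)) - f (z i) = partial i f (\<xi> i) * (y i - x i)" by metis
  have "f y - f x = (\<Sum>i<n. f (z (Suc i)) - f (z i))"
    using sum_lessThan_telescope[of "\<lambda>k. f (z k)" n] by (simp add: z0 zn)
  also have "\<dots> = (\<Sum>i<n. partial i f (\<xi> i) * (y i - x i))" using \<xi> by (intro sum.cong) auto
  finally show ?thesis using \<xi> by blast
qed

text \<open>
  Continuity of the partial derivatives makes the intermediate points of the increment formula
  harmless in the limit. Stating this along a curve avoids a notion of total derivative on n-space.
\<close>

lemma chain_rule: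
  assumes f: "smooth_Rn n f"
    and c: "\<And>i. i < n \<Longrightarrow> (c i has_real_derivative c' i) (at t)"
  shows "((\<lambda>t. f (\<lambda>i\<in>{..<n}. c i t)) has_real_derivative
           (\<Sum>i<n. c' i * partial i f (\<lambda>i\<in>{..<n}. c i t))) (at t)"
proof -
  define C where "C = (\<lambda>t. \<lambda>i\<in>{..<n}. c i t)"
  have CR: "C s \<in> Rn n" for s by (simp add: C_def)
  have "\<forall>s. \<exists>\<xi>. (\<forall>i<n. \<xi> i \<in> Rn n \<and> (\<forall>k<n. \<bar>\<xi> i k - C t k\<bar> \<le> \<bar>C s k - C t k\<bar>)) \<and>
           f (C s) - f (C t) = (\<Sum>i<n. partial i f (\<xi> i) * (C s i - C t i))"
    using increment_coordinates[OF f CR CR] by blast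
  from choice[OF this] obtain \<xi> where "\<forall>s. (\<forall>i<n. \<xi> s i \<in> Rn n \<and> (\<forall>k<n. \<bar>\<xi> s i k - C t k\<bar> \<le> \<bar>C s k - C t k\<bar>)) \<and>
           f (C s) - f (C t) = (\<Sum>i<n. partial i f (\<xi> s i) * (C s i - C t i))" ..
  then have \<xi>: "\<And>s i. i < n \<Longrightarrow> \<xi> s i \<in> Rn n"
    "\<And>s i k. i < n \<Longrightarrow> k < n \<Longrightarrow> \<bar>\<xi> s i k - C t k\<bar> \<le> \<bar>C s k - C t k\<bar>"
    "\<And>s. f (C s) - f (C t) = (\<Sum>i<n. partial i f (\<xi> s i) * (C s i - C t i))"
    by blast+
  have lim: "((\<lambda>s. partial i f (\<xi> s i)) \<longlongrightarrow> partial i f (C t)) (at t)" if i: "i < n" for i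
  proof (rule continuous_on_tendsto_compose[OF smooth_continuous[OF smooth_partial[OF f i]] _ CR])
    show "((\<lambda>s. \<xi> s i) \<longlongrightarrow> C t) (at t)"
    proof (rule tendsto_Rn[OF \<xi>(1)[OF i] CR])
      fix k assume k: "k < n"
      have "isCont (c k) t" using c[OF k] by (rule DERIV_isCont)
      then have "((\<lambda>s. C s k) \<longlongrightarrow> C t k) (at t)" using k by (simp add: C_def isCont_def)
      then have "((\<lambda>s. C s k - C t k) \<longlongrightarrow> 0) (at t)" by (simp add: LIM_zero_iff)
      then have "((\<lambda>s. \<xi> s i k - C t k) \<longlongrightarrow> 0) (at t)"
        by (rule Lim_null_comparison[rotated, OF tendsto_rabs_zero]) (use \<xi>(2)[OF i k] in simp)
      then show "((\<lambda>s. \<xi> s i k) \<longlongrightarrow> C t k) (at t)" by (simp add: LIM_zero_iff)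
    qed
    show "\<forall>\<^sub>F s in at t. \<xi> s i \<in> Rn n" using \<xi>(1)[OF i] by simp
  qed
  have quot: "((\<lambda>s. (C s i - C t i) / (s - t)) \<longlongrightarrow> c' i) (at t)" if i: "i < n" for i
    using c[OF i] i by (simp add: has_field_derivative_iff C_def)
  have "((\<lambda>s. \<Sum>i<n. ((C s i - C t i) / (s - t)) * partial i f (\<xi> s i)) \<longlongrightarrow>
      (\<Sum>i<n. c' i * partial i f (C t))) (at t)"
    by (intro tendsto_sum tendsto_mult lim quot) auto
  then have "((\<lambda>s. (f (C s) - f (C t)) / (s - t)) \<longlongrightarrow> (\<Sum>i<n. c' i * partial i f (C t))) (at t)"
    unfolding \<xi>(3) by (simp add: sum_divide_distrib mult.commute)
  then show ?thesis by (simp add: has_field_derivative_iff C_def)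
qed

text \<open>
  The second difference over a square of side \<open>h\<close>, divided by \<open>h\<^sup>2\<close>, is a value of either mixed
  derivative at a point close to \<open>x\<close>, depending on which variable the mean value theorem is applied to
  first.
\<close>

lemma partial_commute:
  assumes f: "smooth_Rn n f" and i: "i < n" and j: "j < n" and x: "x \<in> Rn n"
  shows "partial i (partial j f) x = partial j (partial i f) x"
proof (cases "i = j")
  case False
  define X where "X s t = x(i := x i + s, j := x j + t)" for s t
  have XR: "X s t \<in> Rn n" for s t using x i j by (simp add: X_def Rn_upd)
  have X0: "X 0 0 = x" by (simp add: X_def)
  have di: "((\<lambda>s. g (X s t)) has_real_derivative partial i g (X s t)) (at s)" if g: "smooth_Rn n g" for g s t
  proof -
    have e: "X s t = (x(j := x j + t))(i := x i + s)" for s using False by (auto simp: X_def)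
    have "((\<lambda>s. g ((x(j := x j + t))(i := s))) has_real_derivative partial i g ((x(j := x j + t))(i := s + x i))) (at (s + x i))"
      by (rule smooth_DERIV_coord[OF g i Rn_upd[OF x j]])
    then show ?thesis unfolding e DERIV_shift by (simp add: add.commute)
  qed
  have dj: "((\<lambda>t. g (X s t)) has_real_derivative partial j g (X s t)) (at t)" if g: "smooth_Rn n g" for g s t
  proof -
    have "((\<lambda>t. g ((x(i := x i + s))(j := t))) has_real_derivative partial j g ((x(i := x i + s))(j := t + x j))) (at (t + x j))"
      by (rule smooth_DERIV_coord[OF g j Rn_upd[OF x i]])
    then show ?thesis unfolding X_def DERIV_shift by (simp add: add.commute)
  qed
  define D where "D h = f (X h h) - f (X h 0) - f (X 0 h) + f (X 0 0)" for h
  have 1: "\<exists>s t. \<bar>s\<bar> \<le> \<bar>h\<bar> \<and> \<bar>t\<bar> \<le> \<bar>h\<bar> \<and> D h = h * h * partial j (partial i f) (X s t)" for h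
  proof -
    obtain s where s: "\<bar>s - 0\<bar> \<le> \<bar>h - 0\<bar>"
      "(f (X h h) - f (X h 0)) - (f (X 0 h) - f (X 0 0)) = (partial i f (X s h) - partial i f (X s 0)) * (h - 0)"
      by (rule MVT_between[of "\<lambda>s. f (X s h) - f (X s 0)" _ 0 h, OF DERIV_diff[OF di[OF f] di[OF f]]])
    obtain t where t: "\<bar>t - 0\<bar> \<le> \<bar>h - 0\<bar>"
      "partial i f (X s h) - partial i f (X s 0) = partial j (partial i f) (X s t) * (h - 0)"
      by (rule MVT_between[of "\<lambda>t. partial i f (X s t)" _ 0 h, OF dj[OF smooth_partial[OF f i]]])
    show ?thesis using s t by (rule_tac exI[of _ s], rule_tac exI[of _ t]) (simp add: D_def algebra_simps)
  qed
  have 2: "\<exists>s t. \<bar>s\<bar> \<le> \<bar>h\<bar> \<and> \<bar>t\<bar> \<le> \<bar>h\<bar> \<and> D h = h * h * partial i (partial j f) (X s t)" for h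
  proof -
    obtain s where s: "\<bar>s - 0\<bar> \<le> \<bar>h - 0\<bar>"
      "(f (X h h) - f (X 0 h)) - (f (X h 0) - f (X 0 0)) = (partial j f (X h s) - partial j f (X 0 s)) * (h - 0)"
      by (rule MVT_between[of "\<lambda>s. f (X h s) - f (X 0 s)" _ 0 h, OF DERIV_diff[OF dj[OF f] dj[OF f]]])
    obtain t where t: "\<bar>t - 0\<bar> \<le> \<bar>h - 0\<bar>"
      "partial j f (X h s) - partial j f (X 0 s) = partial i (partial j f) (X t s) * (h - 0)"
      by (rule MVT_between[of "\<lambda>t. partial j f (X t s)" _ 0 h, OF di[OF smooth_partial[OF f j]]])
    show ?thesis using s t by (rule_tac exI[of _ t], rule_tac exI[of _ s]) (simp add: D_def algebra_simps)
  qed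
  from 1 obtain s t where st: "\<And>h. \<bar>s h\<bar> \<le> \<bar>h\<bar>" "\<And>h. \<bar>t h\<bar> \<le> \<bar>h\<bar>"
    "\<And>h. D h = h * h * partial j (partial i f) (X (s h) (t h))" by metis
  from 2 obtain s' t' where st': "\<And>h. \<bar>s' h\<bar> \<le> \<bar>h\<bar>" "\<And>h. \<bar>t' h\<bar> \<le> \<bar>h\<bar>"
    "\<And>h. D h = h * h * partial i (partial j f) (X (s' h) (t' h))" by metis
  have lim: "((\<lambda>h. g (X (a h) (b h))) \<longlongrightarrow> g x) (at 0)"
    if g: "smooth_Rn n g" and a: "\<And>h. \<bar>a h\<bar> \<le> \<bar>h\<bar>" and b: "\<And>h. \<bar>b h\<bar> \<le> \<bar>h\<bar>" for g a b
  proof (rule continuous_on_tendsto_compose[OF smooth_continuous[OF g] _ x])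
    have a0: "(a \<longlongrightarrow> 0) (at 0)" by (rule Lim_null_comparison[OF _ tendsto_rabs_zero[OF tendsto_ident_at]]) (use a in simp)
    have b0: "(b \<longlongrightarrow> 0) (at 0)" by (rule Lim_null_comparison[OF _ tendsto_rabs_zero[OF tendsto_ident_at]]) (use b in simp)
    show "((\<lambda>h. X (a h) (b h)) \<longlongrightarrow> x) (at 0)"
    proof (rule tendsto_Rn[OF XR x])
      fix k
      show "((\<lambda>h. X (a h) (b h) k) \<longlongrightarrow> x k) (at 0)"
        using tendsto_add[OF tendsto_const[of "x i"] a0] tendsto_add[OF tendsto_const[of "x j"] b0]
        by (cases "k = j"; cases "k = i") (simp_all add: X_def)
    qed
  qed (simp add: XR)
  have l1: "((\<lambda>h. partial j (partial i f) (X (s h) (t h))) \<longlongrightarrow> partial j (partial i f) x) (at 0)"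
    by (intro lim smooth_partial f i j st)
  have l2: "((\<lambda>h. partial i (partial j f) (X (s' h) (t' h))) \<longlongrightarrow> partial i (partial j f) x) (at 0)"
    by (intro lim smooth_partial f i j st')
  have "\<forall>\<^sub>F h in at (0::real). partial j (partial i f) (X (s h) (t h)) = partial i (partial j f) (X (s' h) (t' h))"
    unfolding eventually_at_filter
  proof (intro always_eventually allI impI)
    fix h :: real assume "h \<noteq> 0"
    then show "partial j (partial i f) (X (s h) (t h)) = partial i (partial j f) (X (s' h) (t' h))"
      using st(3)[of h] st'(3)[of h] by simp
  qed
  then have "((\<lambda>h. partial i (partial j f) (X (s' h) (t' h))) \<longlongrightarrow> partial j (partial i f) x) (at 0)"
    using l1 by (rule Lim_transform_eventually[rotated])
  then show ?thesis using l2 by (intro tendsto_unique[of "at (0::real)"]) auto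
qed simp

section \<open>Linear combinations, directional derivatives and composition\<close>

lemma smooth_foldr: "smooth_Rn n f \<Longrightarrow> set ks \<subseteq> {..<n} \<Longrightarrow> smooth_Rn n (foldr partial ks f)"
  by (induction ks) (auto intro: smooth_partial)

lemma foldr_partial_sum:
  assumes I: "finite I" and F: "\<And>a. a \<in> I \<Longrightarrow> smooth_Rn n (F a)" and "set ks \<subseteq> {..<n}" and "x \<in> Rn n"
  shows "foldr partial ks (\<lambda>x. \<Sum>a\<in>I. c a * F a x) x = (\<Sum>a\<in>I. c a * foldr partial ks (F a) x)"
  using assms(3,4)
proof (induction ks arbitrary: x)
  case (Cons k ks)
  then have k: "k < n" and kss: "set ks \<subseteq> {..<n}" by auto
  let ?S = "\<lambda>x. \<Sum>a\<in>I. c a * F a x"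
  have "((\<lambda>t. foldr partial ks ?S (x(k := t))) has_real_derivative
      (\<Sum>a\<in>I. c a * partial k (foldr partial ks (F a)) (x(k := x k)))) (at (x k))"
    unfolding Cons.IH[OF kss Rn_upd[OF Cons.prems(2) k]]
    by (intro DERIV_sum DERIV_cmult smooth_DERIV_coord[where n = n] smooth_foldr F kss k Cons.prems(2))
  then have "partial k (foldr partial ks ?S) x = (\<Sum>a\<in>I. c a * partial k (foldr partial ks (F a)) (x(k := x k)))"
    by (subst partial_def) (rule DERIV_imp_deriv)
  then show ?case by simp
qed simp

lemma smooth_sum:
  assumes I: "finite I" and F: "\<And>a. a \<in> I \<Longrightarrow> smooth_Rn n (F a)"
  shows "smooth_Rn n (\<lambda>x. \<Sum>a\<in>I. c a * F a x)"
  unfolding smooth_Rn_def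
proof (intro allI impI conjI ballI)
  fix ks assume kss: "set ks \<subseteq> {..<n}"
  let ?S = "\<lambda>x. \<Sum>a\<in>I. c a * F a x"
  have e: "foldr partial ks ?S x = (\<Sum>a\<in>I. c a * foldr partial ks (F a) x)" if "x \<in> Rn n" for x
    by (rule foldr_partial_sum[OF I _ kss that]) (rule F)
  have "continuous_on (Rn n) (\<lambda>x. \<Sum>a\<in>I. c a * foldr partial ks (F a) x)"
    by (intro continuous_intros smooth_continuous smooth_foldr F kss)
  then show "continuous_on (Rn n) (foldr partial ks ?S)"
    by (rule continuous_on_eq) (simp add: e)
  fix k x assume k: "k < n" and x: "x \<in> Rn n"
  have "((\<lambda>t. foldr partial ks ?S (x(k := t))) has_real_derivative
      (\<Sum>a\<in>I. c a * partial k (foldr partial ks (F a)) (x(k := x k)))) (at (x k))"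
    unfolding e[OF Rn_upd[OF x k]]
    by (intro DERIV_sum DERIV_cmult smooth_DERIV_coord[where n = n] smooth_foldr F kss k x)
  then show "(\<lambda>t. foldr partial ks ?S (x(k := t))) differentiable at (x k)"
    using real_differentiable_def by blast
qed

lemma partial_sum:
  assumes "finite I" "\<And>a. a \<in> I \<Longrightarrow> smooth_Rn n (F a)" "k < n" "x \<in> Rn n"
  shows "partial k (\<lambda>x. \<Sum>a\<in>I. c a * F a x) x = (\<Sum>a\<in>I. c a * partial k (F a) x)"
  using foldr_partial_sum[where F = F and n = n and ks = "[k]" and x = x and c = c, OF assms(1) _ _ assms(4)] assms(2,3) by simp

lemma partial_cong:
  assumes "\<And>x. x \<in> Rn n \<Longrightarrow> f x = g x" "k < n" "x \<in> Rn n"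
  shows "partial k f x = partial k g x"
  unfolding partial_def by (simp add: assms Rn_upd)

lemma
  assumes f: "smooth_Rn n f" and g: "smooth_Rn n g"
  shows smooth_add: "smooth_Rn n (\<lambda>x. f x + g x)"
    and partial_add: "k < n \<Longrightarrow> x \<in> Rn n \<Longrightarrow>
      partial k (\<lambda>x. f x + g x) x = partial k f x + partial k g x"
proof -
  \<comment> \<open>A sum over the two booleans reduces this to finite sums.\<close>
  let ?F = "\<lambda>b. if b then f else g"
  have F: "smooth_Rn n (?F b)" for b using f g by simp
  have e: "(\<lambda>x. f x + g x) = (\<lambda>x. \<Sum>b\<in>UNIV. 1 * ?F b x)"
    by (simp add: UNIV_bool add.commute)
  show "smooth_Rn n (\<lambda>x. f x + g x)"
    unfolding e by (rule smooth_sum[OF finite F])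
  assume "k < n" "x \<in> Rn n"
  then show "partial k (\<lambda>x. f x + g x) x = partial k f x + partial k g x"
    unfolding e by (subst partial_sum[OF finite F]) (simp_all add: UNIV_bool)
qed

definition dir_deriv :: "nat \<Rightarrow> (nat \<Rightarrow> real) \<Rightarrow> ((nat \<Rightarrow> real) \<Rightarrow> real) \<Rightarrow> (nat \<Rightarrow> real) \<Rightarrow> real" where
  "dir_deriv n u f x = (\<Sum>i<n. u i * partial i f x)"

definition line :: "nat \<Rightarrow> (nat \<Rightarrow> real) \<Rightarrow> (nat \<Rightarrow> real) \<Rightarrow> real \<Rightarrow> nat \<Rightarrow> real" where
  "line n x u t = (\<lambda>i\<in>{..<n}. x i + t * u i)"

lemma line_Rn [simp]: "line n x u t \<in> Rn n"
  by (simp add: line_def)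

lemma line_0 [simp]: "x \<in> Rn n \<Longrightarrow> line n x u 0 = x"
  by (rule Rn_eqI) (auto simp: line_def)

lemma smooth_dir_deriv: "smooth_Rn n f \<Longrightarrow> smooth_Rn n (dir_deriv n u f)"
  unfolding dir_deriv_def by (rule smooth_sum) (auto intro: smooth_partial)

lemma dir_deriv_cong:
  assumes "\<And>x. x \<in> Rn n \<Longrightarrow> f x = g x" "x \<in> Rn n"
  shows "dir_deriv n u f x = dir_deriv n u g x"
  unfolding dir_deriv_def by (intro sum.cong) (auto simp: partial_cong[OF assms(1) _ assms(2)])

lemma dir_deriv_line:
  assumes "smooth_Rn n f"
  shows "((\<lambda>t. f (line n x u t)) has_real_derivative dir_deriv n u f (line n x u t)) (at t)"
  unfolding line_def dir_deriv_def by (rule chain_rule[OF assms]) (auto intro!: derivative_eq_intros)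

lemma dir_deriv_dir_deriv:
  assumes f: "smooth_Rn n f" and x: "x \<in> Rn n"
  shows "dir_deriv n u (dir_deriv n v f) x = (\<Sum>i<n. \<Sum>j<n. u i * v j * partial i (partial j f) x)"
proof -
  have "partial i (dir_deriv n v f) x = (\<Sum>j<n. v j * partial i (partial j f) x)" if "i < n" for i
    unfolding dir_deriv_def using f that x by (intro partial_sum) (auto intro: smooth_partial)
  then show ?thesis by (subst dir_deriv_def) (simp add: sum_distrib_left mult.assoc)
qed

lemma dir_deriv_commute:
  assumes f: "smooth_Rn n f" and x: "x \<in> Rn n"
  shows "dir_deriv n u (dir_deriv n v f) x = dir_deriv n v (dir_deriv n u f) x"
  unfolding dir_deriv_dir_deriv[OF assms]
  by (subst sum.swap) (intro sum.cong, auto simp: partial_commute[OF f _ _ x] mult.commute)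

lemma dir_deriv_scale: "dir_deriv n (\<lambda>i. a * u i) f x = a * dir_deriv n u f x"
  by (simp add: dir_deriv_def sum_distrib_left mult.assoc)

lemma dir_deriv_basis: "k < n \<Longrightarrow> dir_deriv n (\<lambda>i. if i = k then 1 else 0) f = partial k f"
  by (simp add: dir_deriv_def fun_eq_iff if_distrib[of "\<lambda>a. a * _"] cong: if_cong)

lemma hessian_form_dir_deriv:
  assumes "smooth_Rn n f" "x \<in> Rn n"
  shows "hessian_form n f x u = dir_deriv n u (dir_deriv n u f) x"
  unfolding dir_deriv_dir_deriv[OF assms] hessian_form_def
  by (intro sum.cong) (auto simp: hessian_def)

lemma local_max_second_derivative:
  fixes f f' :: "real \<Rightarrow> real"
  assumes f: "\<And>t. (f has_real_derivative f' t) (at t)"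
    and f': "(f' has_real_derivative f2) (at 0)"
    and max: "\<forall>\<^sub>F t in nhds 0. f t \<le> f 0"
  shows "f' 0 = 0" "f2 \<le> 0"
proof -
  obtain d where d: "d > 0" "\<And>t. \<bar>t\<bar> < d \<Longrightarrow> f t \<le> f 0"
    using max unfolding eventually_nhds_metric by (auto simp: dist_real_def)
  show f0: "f' 0 = 0"
    by (rule DERIV_local_max[OF f d(1)]) (use d(2) in auto)
  show "f2 \<le> 0"
  proof (rule ccontr)
    assume "\<not> f2 \<le> 0"
    then obtain e where e: "e > 0" "\<And>h. 0 < h \<Longrightarrow> h < e \<Longrightarrow> f' 0 < f' (0 + h)"
      using DERIV_pos_inc_right[OF f'] by auto
    define h where "h = min d e / 2"
    have h: "0 < h" "h < d" "h < e" using d(1) e(1) by (auto simp: h_def)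
    obtain z where z: "0 < z" "z < h" "f h - f 0 = (h - 0) * f' z"
      using MVT2[OF h(1) f] by blast
    have "f' z > 0" using e(2)[of z] z h f0 by auto
    then have "f h > f 0" using z h by (simp add: algebra_simps)
    with d(2)[of h] h show False by auto
  qed
qed

text \<open>
  With the components of \<open>\<nabla>\<phi>\<close> for \<open>G\<close>, these are the derivatives along a line of the term
  \<open>W(\<nabla>\<phi>)\<close> of a Monge-Ampere equation.
\<close>

lemma composition_derivatives:
  fixes x u :: "nat \<Rightarrow> real"
  assumes W: "smooth_Rn n W" and G: "\<And>k. k < n \<Longrightarrow> smooth_Rn n (G k)"
  defines "Y \<equiv> \<lambda>x. \<lambda>k\<in>{..<n}. G k x"
  defines "f' \<equiv> \<lambda>t. \<Sum>k<n. dir_deriv n u (G k) (line n x u t) * partial k W (Y (line n x u t))"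
  shows "((\<lambda>t. W (Y (line n x u t))) has_real_derivative f' t) (at t)"
    and "(f' has_real_derivative
           (\<Sum>k<n. dir_deriv n u (dir_deriv n u (G k)) (line n x u t) * partial k W (Y (line n x u t))) +
           (\<Sum>k<n. \<Sum>l<n. dir_deriv n u (G k) (line n x u t) * dir_deriv n u (G l) (line n x u t)
              * partial l (partial k W) (Y (line n x u t)))) (at t)"
proof -
  have comp: "((\<lambda>t. H (Y (line n x u t))) has_real_derivative
      (\<Sum>k<n. dir_deriv n u (G k) (line n x u t) * partial k H (Y (line n x u t)))) (at t)"
    if "smooth_Rn n H" for H t
    unfolding Y_def by (intro chain_rule that dir_deriv_line G)
  show "((\<lambda>t. W (Y (line n x u t))) has_real_derivative f' t) (at t)"
    unfolding f'_def by (rule comp[OF W])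
  have "(f' has_real_derivative
       (\<Sum>k<n. dir_deriv n u (dir_deriv n u (G k)) (line n x u t) * partial k W (Y (line n x u t)) +
          (\<Sum>l<n. dir_deriv n u (G l) (line n x u t) * partial l (partial k W) (Y (line n x u t)))
            * dir_deriv n u (G k) (line n x u t))) (at t)"
    unfolding f'_def
    by (intro DERIV_sum DERIV_mult dir_deriv_line smooth_dir_deriv G comp smooth_partial W) auto
  then show "(f' has_real_derivative
           (\<Sum>k<n. dir_deriv n u (dir_deriv n u (G k)) (line n x u t) * partial k W (Y (line n x u t))) +
           (\<Sum>k<n. \<Sum>l<n. dir_deriv n u (G k) (line n x u t) * dir_deriv n u (G l) (line n x u t)
              * partial l (partial k W) (Y (line n x u t)))) (at t)"
    by (simp add: sum.distrib sum_distrib_left mult.commute mult.left_commute)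
qed

section \<open>Positive definite matrices\<close>

definition bilin :: "nat \<Rightarrow> (nat \<Rightarrow> nat \<Rightarrow> real) \<Rightarrow> (nat \<Rightarrow> real) \<Rightarrow> (nat \<Rightarrow> real) \<Rightarrow> real" where
  "bilin n B u v = (\<Sum>i<n. \<Sum>j<n. u i * v j * B i j)"

definition pos_def :: "nat \<Rightarrow> (nat \<Rightarrow> nat \<Rightarrow> real) \<Rightarrow> bool" where
  "pos_def n B \<longleftrightarrow> (\<forall>i<n. \<forall>j<n. B i j = B j i) \<and> (\<forall>v. (\<exists>i<n. v i \<noteq> 0) \<longrightarrow> bilin n B v v > 0)"

lemma pos_def_pos: "pos_def n B \<Longrightarrow> i < n \<Longrightarrow> v i \<noteq> 0 \<Longrightarrow> bilin n B v v > 0"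
  unfolding pos_def_def by blast

lemma bilin_basis: "i < n \<Longrightarrow> j < n \<Longrightarrow>
    bilin n B (\<lambda>k. if k = i then 1 else 0) (\<lambda>k. if k = j then 1 else 0) = B i j"
  by (simp add: bilin_def if_distrib[of "\<lambda>a. a * _"] if_distrib[of "\<lambda>a. _ * a"] cong: if_cong)

lemma pos_def_diag: "pos_def n B \<Longrightarrow> i < n \<Longrightarrow> B i i > 0"
  using pos_def_pos[of n B i "\<lambda>k. if k = i then 1 else 0"] by (simp add: bilin_basis)

lemma bilin_commute: "pos_def n B \<Longrightarrow> bilin n B u v = bilin n B v u"
  unfolding bilin_def pos_def_def by (subst sum.swap) (intro sum.cong, auto)

lemma bilin_lincomb_left: "bilin n B (\<lambda>i. a * u i + b * v i) w = a * bilin n B u w + b * bilin n B v w"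
  by (simp add: bilin_def sum_distrib_left sum.distrib algebra_simps)

lemma bilin_lincomb_right: "bilin n B w (\<lambda>i. a * u i + b * v i) = a * bilin n B w u + b * bilin n B w v"
  by (simp add: bilin_def sum_distrib_left sum.distrib algebra_simps)

lemma bilin_sum_left: "bilin n B (\<lambda>i. \<Sum>a\<in>I. c a * u a i) w = (\<Sum>a\<in>I. c a * bilin n B (u a) w)"
proof -
  have "bilin n B (\<lambda>i. \<Sum>a\<in>I. c a * u a i) w = (\<Sum>i<n. \<Sum>j<n. \<Sum>a\<in>I. c a * u a i * w j * B i j)"
    by (simp add: bilin_def sum_distrib_right)
  also have "\<dots> = (\<Sum>i<n. \<Sum>a\<in>I. \<Sum>j<n. c a * u a i * w j * B i j)"
    by (intro sum.cong refl sum.swap)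
  also have "\<dots> = (\<Sum>a\<in>I. \<Sum>i<n. \<Sum>j<n. c a * u a i * w j * B i j)" by (rule sum.swap)
  finally show ?thesis by (simp add: bilin_def sum_distrib_left mult.assoc)
qed

lemma bilin_sum_right: "bilin n B w (\<lambda>i. \<Sum>a\<in>I. c a * u a i) = (\<Sum>a\<in>I. c a * bilin n B w (u a))"
proof -
  have flip: "bilin n B x y = bilin n (\<lambda>i j. B j i) y x" for x y
    unfolding bilin_def by (subst sum.swap) (simp add: mult.commute mult.left_commute)
  show ?thesis unfolding flip[of w] by (rule bilin_sum_left)
qed

abbreviation fmat :: "nat \<Rightarrow> (nat \<Rightarrow> nat \<Rightarrow> real) \<Rightarrow> real mat" where
  "fmat n B \<equiv> Matrix.mat n n (\<lambda>(i, j). B i j)"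

lemma fmat_mult: "fmat n A * fmat n B = fmat n (\<lambda>i j. \<Sum>k<n. A i k * B k j)"
  by (rule eq_matI) (simp_all add: scalar_prod_def atLeast0LessThan)

lemma fmat_cong: "(\<And>i j. i < n \<Longrightarrow> j < n \<Longrightarrow> A i j = B i j) \<Longrightarrow> fmat n A = fmat n B"
  by (rule eq_matI) simp_all

lemma prod_list_diag_1:
  assumes "\<And>i. i < n \<Longrightarrow> A i i = 1"
  shows "prod_list (diag_mat (fmat n A)) = 1"
proof -
  have "diag_mat (fmat n A) = replicate n 1"
    by (rule nth_equalityI) (auto simp: diag_mat_def assms)
  then show ?thesis by simp
qed

lemma det_unit_lower:
  assumes "\<And>i j. i < j \<Longrightarrow> j < n \<Longrightarrow> A i j = 0" "\<And>i. i < n \<Longrightarrow> A i i = 1"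
  shows "Determinant.det (fmat n A) = 1"
  by (subst det_lower_triangular[where n = n]) (auto simp: assms prod_list_diag_1)

lemma det_unit_upper:
  assumes "\<And>i j. j < i \<Longrightarrow> i < n \<Longrightarrow> A i j = 0" "\<And>i. i < n \<Longrightarrow> A i i = 1"
  shows "Determinant.det (fmat n A) = 1"
  by (subst det_upper_triangular[where n = n]) (auto simp: assms prod_list_diag_1)

lemma det_fmat_0_iff:
  "Determinant.det (fmat n A) = 0 \<longleftrightarrow> (\<exists>v. (\<exists>i<n. v i \<noteq> 0) \<and> (\<forall>i<n. (\<Sum>j<n. A i j * v j) = 0))"
proof
  assume "Determinant.det (fmat n A) = 0"
  then obtain v where v: "v \<in> carrier_vec n" "v \<noteq> 0\<^sub>v n" "fmat n A *\<^sub>v v = 0\<^sub>v n"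
    using det_0_iff_vec_prod_zero[of "fmat n A" n] by auto
  have "\<exists>i<n. vec_index v i \<noteq> 0" using v(1,2) by (metis carrier_vecD eq_vecI index_zero_vec(1,2))
  moreover have "(\<Sum>j<n. A i j * vec_index v j) = 0" if "i < n" for i
    using arg_cong[OF v(3), of "\<lambda>w. vec_index w i"] that v(1)
    by (simp add: scalar_prod_def atLeast0LessThan)
  ultimately show "\<exists>v. (\<exists>i<n. v i \<noteq> 0) \<and> (\<forall>i<n. (\<Sum>j<n. A i j * v j) = 0)" by blast
next
  assume "\<exists>v. (\<exists>i<n. v i \<noteq> 0) \<and> (\<forall>i<n. (\<Sum>j<n. A i j * v j) = 0)"
  then obtain v i where v: "i < n" "v i \<noteq> 0" "\<forall>i<n. (\<Sum>j<n. A i j * v j) = 0" by blast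
  have "fmat n A *\<^sub>v Matrix.vec n v = 0\<^sub>v n"
    by (rule eq_vecI) (simp_all add: scalar_prod_def atLeast0LessThan v(3))
  moreover have "Matrix.vec n v \<noteq> 0\<^sub>v n"
    using v(1,2) by (metis index_vec index_zero_vec(1))
  ultimately show "Determinant.det (fmat n A) = 0"
    using det_0_iff_vec_prod_zero[of "fmat n A" n] by (metis mat_carrier vec_carrier)
qed

text \<open>
  The form of the Schur complement at \<open>v\<close> is the minimum of the form of \<open>B\<close> over all extensions of \<open>v\<close>
  by one coordinate.
\<close>

lemma pos_def_Schur:
  assumes B: "pos_def (Suc n) B"
  shows "pos_def n (\<lambda>i j. B i j - B i n * B n j / B n n)"
  unfolding pos_def_def
proof (intro conjI allI impI)
  let ?b = "B n n" and ?S = "\<lambda>i j. B i j - B i n * B n j / B n n"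
  have b: "?b > 0" using pos_def_diag[OF B, of n] by simp
  have sym: "B i j = B j i" if "i < Suc n" "j < Suc n" for i j using B that by (auto simp: pos_def_def)
  fix i j assume "i < n" "j < n"
  then show "?S i j = ?S j i" using sym[of i j] sym[of i n] sym[of j n] by simp
next
  let ?b = "B n n" and ?S = "\<lambda>i j. B i j - B i n * B n j / B n n"
  have b: "?b > 0" using pos_def_diag[OF B, of n] by simp
  have sym: "B i j = B j i" if "i < Suc n" "j < Suc n" for i j using B that by (auto simp: pos_def_def)
  fix v :: "nat \<Rightarrow> real" assume "\<exists>i<n. v i \<noteq> 0"
  then obtain i where i: "i < n" "v i \<noteq> 0" by blast
  define s where "s = (\<Sum>j<n. v j * B n j)"
  \<comment> \<open>The last coordinate that minimises the form.\<close>
  define r where "r = - s / ?b"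
  define w where "w = (\<lambda>i. if i < n then v i else r)"
  have "bilin (Suc n) B w w > 0" using i by (intro pos_def_pos[OF B, of i]) (auto simp: w_def)
  also have "bilin (Suc n) B w w = bilin n B v v + (\<Sum>i<n. v i * r * B i n)
      + (\<Sum>j<n. r * v j * B n j) + r * r * ?b"
    by (simp add: bilin_def w_def sum.distrib)
  also have "(\<Sum>i<n. v i * r * B i n) = r * s"
    unfolding s_def sum_distrib_left by (intro sum.cong) (auto simp: sym)
  also have "(\<Sum>j<n. r * v j * B n j) = r * s"
    by (simp add: s_def sum_distrib_left mult.assoc)
  also have "bilin n B v v + r * s + r * s + r * r * ?b
      = bilin n B v v - s * s / ?b" using b by (simp add: r_def field_simps)
  also have "s * s / ?b = (\<Sum>i<n. \<Sum>j<n. v i * v j * (B i n * B n j / ?b))"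
    unfolding s_def sum_product sum_divide_distrib by (intro sum.cong) (auto simp: sym)
  also have "bilin n B v v - \<dots> = bilin n ?S v v"
    by (simp add: bilin_def sum_subtractf right_diff_distrib)
  finally show "bilin n ?S v v > 0" .
qed

text \<open>
  Adding multiples of the last column to the others clears the last row and leaves the Schur
  complement, whose diagonal is smaller than that of \<open>B\<close>; induct.
\<close>

lemma Hadamard:
  assumes "pos_def n B"
  shows "Determinant.det (fmat n B) \<le> (\<Prod>i<n. B i i)"
  using assms
proof (induction n arbitrary: B)
  case 0 then show ?case by simp
next
  case (Suc n)
  let ?b = "B n n"
  define S where "S = (\<lambda>i j. B i j - B i n * B n j / B n n)"
  define U where "U = (\<lambda>i j. if i = j then 1 else if i = n then - B n j / ?b else (0::real))"
  define X where "X = (\<lambda>i j. if j = n then B i n else S i j)"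
  have b: "?b > 0" using pos_def_diag[OF Suc.prems, of n] by simp
  have sym: "B i j = B j i" if "i < Suc n" "j < Suc n" for i j using Suc.prems that by (auto simp: pos_def_def)
  have S: "pos_def n S" unfolding S_def by (rule pos_def_Schur[OF Suc.prems])
  have BU: "fmat (Suc n) B * fmat (Suc n) U = fmat (Suc n) X"
    unfolding fmat_mult
  proof (rule fmat_cong)
    fix i j assume ij: "i < Suc n" "j < Suc n"
    show "(\<Sum>k<Suc n. B i k * U k j) = X i j"
    proof (cases "j = n")
      case True
      then have "(\<Sum>k<n. B i k * U k j) = 0" by (intro sum.neutral) (auto simp: U_def)
      then show ?thesis using True by (simp add: U_def X_def)
    next
      case False
      then have "(\<Sum>k<n. B i k * U k j) = (\<Sum>k<n. if k = j then B i k else 0)"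
        by (intro sum.cong) (auto simp: U_def)
      then show ?thesis using False ij by (simp add: U_def X_def S_def)
    qed
  qed
  have "Determinant.det (fmat (Suc n) B) = Determinant.det (fmat (Suc n) B * fmat (Suc n) U)"
    by (subst det_mult[where n = "Suc n"]) (auto simp: det_unit_lower U_def)
  also have "\<dots> = (\<Sum>j<Suc n. X n j * cofactor (fmat (Suc n) X) n j)"
    unfolding BU by (subst laplace_expansion_row[where n = "Suc n" and i = n]) auto
  also have "\<dots> = ?b * cofactor (fmat (Suc n) X) n n"
    using b by (simp add: X_def S_def)
  also have "mat_delete (fmat (Suc n) X) n n = fmat n S"
    by (rule eq_matI) (auto simp: mat_delete_def X_def)
  then have "cofactor (fmat (Suc n) X) n n = Determinant.det (fmat n S)"
    by (simp add: cofactor_def power_add[symmetric])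
  finally have "Determinant.det (fmat (Suc n) B) = ?b * Determinant.det (fmat n S)" .
  also have "\<dots> \<le> ?b * (\<Prod>i<n. S i i)" using Suc.IH[OF S] b by simp
  also have "(\<Prod>i<n. S i i) \<le> (\<Prod>i<n. B i i)"
  proof (rule prod_mono)
    fix i assume "i \<in> {..<n}"
    then have i: "i < n" by simp
    have "B i n * B n i / ?b = (B i n)\<^sup>2 / ?b" using sym[of i n] i by (simp add: power2_eq_square)
    then show "0 \<le> S i i \<and> S i i \<le> B i i" using pos_def_diag[OF S i] b by (auto simp: S_def)
  qed
  finally show ?case using b by (simp add: mult.commute)
qed

text \<open>
  Gram-Schmidt for the inner product \<open>B\<close>, starting from \<open>u\<close>. A vector orthogonal to fewer than \<open>n\<close>
  given ones exists because the matrix of these conditions, padded with zero rows, is singular.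
\<close>

lemma orthonormal_frame:
  assumes B: "pos_def n B" and u: "bilin n B u u = 1" and n: "0 < n"
  shows "\<exists>v. v 0 = u \<and> (\<forall>i<n. \<forall>j<n. bilin n B (v i) (v j) = (if i = j then 1 else 0))"
proof -
  have "\<exists>v. v 0 = u \<and> (\<forall>i<Suc k. \<forall>j<Suc k. bilin n B (v i) (v j) = (if i = j then 1 else 0))" if "k < n" for k
    using that
  proof (induction k)
    case 0
    show ?case by (rule exI[of _ "\<lambda>_. u"]) (simp add: u)
  next
    case (Suc k)
    then obtain v where v: "v 0 = u" "\<And>i j. i < Suc k \<Longrightarrow> j < Suc k \<Longrightarrow> bilin n B (v i) (v j) = (if i = j then 1 else 0)"
      by (metis Suc_lessD)
    define N where "N = (\<lambda>i j. if i < Suc k then (\<Sum>l<n. v i l * B l j) else 0)"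
    have "row (fmat n N) (Suc k) = 0\<^sub>v n" using Suc.prems by (auto simp: N_def intro!: eq_vecI)
    then have "Determinant.det (fmat n N) = 0" using Suc.prems by (subst laplace_expansion_row[where n = n and i = "Suc k"]) (auto simp: N_def)
    then obtain w where w: "\<exists>i<n. w i \<noteq> 0" "\<And>i. i < n \<Longrightarrow> (\<Sum>j<n. N i j * w j) = 0"
      unfolding det_fmat_0_iff by blast
    have orth: "bilin n B (v i) w = 0" if "i < Suc k" for i
    proof -
      have "bilin n B (v i) w = (\<Sum>j<n. N i j * w j)"
        unfolding bilin_def using that by (subst sum.swap) (simp add: N_def sum_distrib_left sum_distrib_right mult_ac)
      then show ?thesis using w(2)[of i] that Suc.prems by simp
    qed
    define r where "r = sqrt (bilin n B w w)"
    have r: "r > 0" "r * r = bilin n B w w" using w(1) pos_def_pos[OF B] by (fastforce simp: r_def less_imp_le)+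
    define z where "z = (\<lambda>i. (1 / r) * w i + 0 * w i)"
    have z: "bilin n B y z = bilin n B y w / r" "bilin n B z y = bilin n B w y / r" for y
      unfolding z_def bilin_lincomb_left bilin_lincomb_right by simp_all
    have zz: "bilin n B z z = 1" using r by (simp add: z(1)) (simp add: z(2) field_simps)
    have oz: "bilin n B (v i) z = 0" "bilin n B z (v i) = 0" if "i < Suc k" for i
      using orth[OF that] bilin_commute[OF B, of w "v i"] by (simp_all add: z)
    show ?case
      by (rule exI[of _ "v(Suc k := z)"]) (use v zz oz in \<open>auto simp: less_Suc_eq\<close>)
  qed
  from this[of "n - 1"] n show ?thesis by simp
qed

lemma det_gram:
  "Determinant.det (fmat n (\<lambda>i j. bilin n B (g i) (g j))) =
     Determinant.det (fmat n B) * (Determinant.det (fmat n (\<lambda>k i. g i k)))\<^sup>2"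
proof -
  have "fmat n (\<lambda>i j. bilin n B (g i) (g j)) = fmat n (\<lambda>i k. g i k) * (fmat n B * fmat n (\<lambda>k i. g i k))"
    unfolding fmat_mult by (rule fmat_cong) (simp add: bilin_def sum_distrib_left mult_ac)
  moreover have "fmat n (\<lambda>i k. g i k) = transpose_mat (fmat n (\<lambda>k i. g i k))"
    by (rule eq_matI) auto
  moreover have "Determinant.det (transpose_mat G * (fmat n B * G)) = Determinant.det (transpose_mat G) * (Determinant.det (fmat n B) * Determinant.det G)"
    if "G \<in> carrier_mat n n" for G
  proof -
    have "fmat n B * G \<in> carrier_mat n n" by (rule mult_carrier_mat[OF _ that]) simp
    then have "Determinant.det (transpose_mat G * (fmat n B * G)) = Determinant.det (transpose_mat G) * Determinant.det (fmat n B * G)"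
      by (intro det_mult) (use that in auto)
    also have "Determinant.det (fmat n B * G) = Determinant.det (fmat n B) * Determinant.det G"
      by (rule det_mult[OF _ that]) simp
    finally show ?thesis .
  qed
  ultimately show ?thesis
    by (simp add: det_transpose[where n = n] power2_eq_square)
qed

text \<open>
  Hadamard's inequality for the Gram matrix of a frame. Shearing the frame along \<open>v 0\<close> does not change
  its determinant, but the right-hand side depends on the shear. This freedom is what later yields
  the squares of third derivatives in the second variation of the logarithm of the determinant.
\<close>

lemma det_le_sheared_frame:
  assumes A0: "\<And>i j. i < n \<Longrightarrow> j < n \<Longrightarrow> bilin n A0 (v i) (v j) = (if i = j then 1 else 0)"
    and A: "pos_def n A" and s: "s 0 = 0"
  defines "g i \<equiv> \<lambda>k. 1 * v i k + s i * v 0 k"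
  shows "Determinant.det (fmat n A) \<le> Determinant.det (fmat n A0) * (\<Prod>i<n. bilin n A (g i) (g i))"
proof -
  let ?V = "fmat n (\<lambda>k i. v i k)" and ?G = "fmat n (\<lambda>k i. g i k)"
  define U where "U = (\<lambda>k i. if k = i then 1 else if k = 0 then s i else (0::real))"
  have "?V * fmat n U = ?G"
    unfolding fmat_mult
  proof (rule fmat_cong)
    fix k i assume ki: "k < n" "i < n"
    have "(\<Sum>m<n. v m k * U m i) = (\<Sum>m<n. (if m = i then v m k else 0) + (if m = 0 then s i * v m k else 0))"
      by (intro sum.cong) (auto simp: U_def s)
    also have "\<dots> = g i k" using ki by (simp add: sum.distrib g_def)
    finally show "(\<Sum>m<n. v m k * U m i) = g i k" .
  qed
  then have dG: "Determinant.det ?G = Determinant.det ?V"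
    using det_mult[of ?V n "fmat n U"] by (simp add: det_unit_upper U_def)
  have "fmat n (\<lambda>i j. bilin n A0 (v i) (v j)) = 1\<^sub>m n" by (rule eq_matI) (auto simp: A0)
  then have one: "Determinant.det (fmat n A0) * (Determinant.det ?V)\<^sup>2 = 1"
    using det_gram[of n A0 v] by simp
  then have G0: "Determinant.det ?G \<noteq> 0" unfolding dG by auto
  have "pos_def n (\<lambda>i j. bilin n A (g i) (g j))"
    unfolding pos_def_def
  proof (intro conjI allI impI)
    fix w :: "nat \<Rightarrow> real" assume w: "\<exists>i<n. w i \<noteq> 0"
    let ?w = "\<lambda>k. \<Sum>i<n. w i * g i k"
    have "\<exists>k<n. ?w k \<noteq> 0"
      using G0 w unfolding det_fmat_0_iff by (metis (no_types, lifting) mult.commute sum.cong)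
    then have "bilin n A ?w ?w > 0" using A by (auto simp: pos_def_def)
    also have "bilin n A ?w ?w = bilin n (\<lambda>i j. bilin n A (g i) (g j)) w w"
      unfolding bilin_sum_left bilin_sum_right by (subst (3) bilin_def) (simp add: sum_distrib_left mult_ac)
    finally show "bilin n (\<lambda>i j. bilin n A (g i) (g j)) w w > 0" .
  qed (rule bilin_commute[OF A])
  from Hadamard[OF this]
  have "Determinant.det (fmat n A) * (Determinant.det ?V)\<^sup>2 \<le> (\<Prod>i<n. bilin n A (g i) (g i))"
    by (simp add: det_gram dG)
  moreover have "(Determinant.det ?V)\<^sup>2 > 0" using one by (auto simp: zero_less_power2)
  ultimately have "Determinant.det (fmat n A) \<le> (1 / (Determinant.det ?V)\<^sup>2) * (\<Prod>i<n. bilin n A (g i) (g i))"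
    by (simp add: field_simps)
  also have "1 / (Determinant.det ?V)\<^sup>2 = Determinant.det (fmat n A0)"
    using one \<open>(Determinant.det ?V)\<^sup>2 > 0\<close> by (simp add: field_simps)
  finally show ?thesis .
qed

text \<open>
  If the form vanishes at \<open>v\<close>, then its nonnegativity at all \<open>e w + v\<close> forces \<open>v\<close> to be orthogonal to
  every \<open>w\<close>, so that \<open>v\<close> lies in the kernel of \<open>B\<close>.
\<close>

lemma pos_def_of_psd:
  assumes sym: "\<And>i j. i < n \<Longrightarrow> j < n \<Longrightarrow> B i j = B j i"
    and psd: "\<And>v. bilin n B v v \<ge> 0" and det: "Determinant.det (fmat n B) \<noteq> 0"
  shows "pos_def n B"
  unfolding pos_def_def
proof (intro conjI allI impI sym)
  fix v :: "nat \<Rightarrow> real" assume v: "\<exists>i<n. v i \<noteq> 0"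
  show "bilin n B v v > 0"
  proof (rule ccontr)
    assume "\<not> bilin n B v v > 0"
    then have v0: "bilin n B v v = 0" using psd[of v] by simp
    have "bilin n B w v = 0" for w
    proof (rule ccontr)
      define b where "b = bilin n B w v"
      define c where "c = bilin n B w w"
      assume "bilin n B w v \<noteq> 0"
      then have b: "b \<noteq> 0" by (simp add: b_def)
      have vw: "bilin n B v w = b"
        unfolding b_def bilin_def by (subst sum.swap) (intro sum.cong, auto simp: sym)
      \<comment> \<open>Small enough that the linear term in the expansion at e w + v wins.\<close>
      define e where "e = - b / (c + 1)"
      have c: "c \<ge> 0" unfolding c_def by (rule psd)
      have "bilin n B (\<lambda>i. e * w i + 1 * v i) (\<lambda>i. e * w i + 1 * v i) = e * e * c + 2 * e * b"
        unfolding bilin_lincomb_left bilin_lincomb_right using v0 vw by (simp add: b_def c_def algebra_simps)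
      also have "\<dots> = - (e * e * (c + 2))"
      proof -
        have b': "b = - e * (c + 1)" using c by (simp add: e_def)
        show ?thesis by (subst b') (simp add: algebra_simps)
      qed
      also have "\<dots> < 0"
      proof -
        have "e \<noteq> 0" using b c by (simp add: e_def)
        then have "e * e > 0" by (auto simp: zero_less_mult_iff)
        then show ?thesis using c by simp
      qed
      finally show False using psd by (meson not_less)
    qed
    then have "(\<Sum>j<n. B i j * v j) = 0" if "i < n" for i
    proof -
      have "bilin n B (\<lambda>k. if k = i then 1 else 0) v = (\<Sum>j<n. B i j * v j)"
      proof -
        have "bilin n B (\<lambda>k. if k = i then 1 else 0) v = (\<Sum>k<n. if k = i then \<Sum>j<n. B k j * v j else 0)"
          unfolding bilin_def by (intro sum.cong) (auto simp: mult.commute)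
        then show ?thesis using that by simp
      qed
      with \<open>\<And>w. bilin n B w v = 0\<close> show ?thesis by simp
    qed
    with v have "Determinant.det (fmat n B) = 0" unfolding det_fmat_0_iff by blast
    with det show False ..
  qed
qed

text \<open>
  The form is nonnegative at the difference of \<open>e\<close> and its projection to the frame.
\<close>

lemma Bessel:
  assumes B: "pos_def n B"
    and v: "\<And>i j. i < n \<Longrightarrow> j < n \<Longrightarrow> bilin n B (v i) (v j) = (if i = j then 1 else 0)"
  shows "(\<Sum>i<n. (bilin n B (v i) e)\<^sup>2) \<le> bilin n B e e"
proof -
  define c where "c = (\<lambda>i. bilin n B (v i) e)"
  let ?w = "\<lambda>k. \<Sum>i<n. c i * v i k"
  let ?d = "\<lambda>k. 1 * e k + (-1) * ?w k"
  have "bilin n B ?d ?d \<ge> 0"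
    using B by (cases "\<exists>i<n. ?d i \<noteq> 0") (auto simp: pos_def_def less_imp_le bilin_def intro!: sum_nonneg)
  also have "bilin n B ?d ?d = bilin n B e e - bilin n B e ?w - bilin n B ?w e + bilin n B ?w ?w"
    unfolding bilin_lincomb_left bilin_lincomb_right by simp
  also have "bilin n B e ?w = bilin n B ?w e" by (rule bilin_commute[OF B])
  also have "bilin n B ?w e = (\<Sum>i<n. (c i)\<^sup>2)" by (simp add: bilin_sum_left c_def power2_eq_square)
  also have "bilin n B ?w ?w = (\<Sum>i<n. c i * (\<Sum>j<n. c j * (if i = j then 1 else 0)))"
    unfolding bilin_sum_left bilin_sum_right by (intro sum.cong refl) (auto simp: v)
  also have "\<dots> = (\<Sum>i<n. (c i)\<^sup>2)"
    by (simp add: if_distrib[of "\<lambda>a. _ * a"] power2_eq_square cong: if_cong)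
  finally show ?thesis by (simp add: c_def)
qed

section \<open>The radial weight\<close>

text \<open>
  The density \<open>\<vartheta>\<close> is continuous and piecewise linear with kinks at \<open>R\<close>, \<open>Q\<close> and \<open>P\<close>, hence a linear
  combination of a constant and positive parts. Below are its slope on \<open>[Q, P]\<close> and its first and second
  antiderivatives vanishing at 0, which for nonnegative arguments are the derivative and the values of
  \<open>psi_bar\<close>.
\<close>

definition theta_slope :: "real \<Rightarrow> real \<Rightarrow> real \<Rightarrow> real" where
  "theta_slope R l lq = lq * l\<^sup>2 / (4 * lq\<^sup>2 + 8 * lq\<^sup>2 * R - l\<^sup>2)"

definition psi_bar_deriv :: "real \<Rightarrow> real \<Rightarrow> real \<Rightarrow> real \<Rightarrow> real" where
  "psi_bar_deriv R l lq s = lq * s - lq * (max 0 (s - R))\<^sup>2 / 2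
     + (lq + theta_slope R l lq) * (max 0 (s - const_Q R l lq))\<^sup>2 / 2
     - theta_slope R l lq * (max 0 (s - const_P R l lq))\<^sup>2 / 2"

definition psi_bar_formula :: "real \<Rightarrow> real \<Rightarrow> real \<Rightarrow> real \<Rightarrow> real" where
  "psi_bar_formula R l lq s = lq * s\<^sup>2 / 2 - lq * (max 0 (s - R)) ^ 3 / 6
     + (lq + theta_slope R l lq) * (max 0 (s - const_Q R l lq)) ^ 3 / 6
     - theta_slope R l lq * (max 0 (s - const_P R l lq)) ^ 3 / 6"

lemma DERIV_pos_part_power:
  "((\<lambda>s::real. (max 0 (s - a)) ^ Suc (Suc k)) has_real_derivative real (Suc (Suc k)) * (max 0 (s - a)) ^ Suc k) (at s)"
proof (cases s a rule: linorder_cases)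
  case less
  have "((\<lambda>s::real. 0) has_real_derivative 0) (at s)" by simp
  moreover have "\<forall>\<^sub>F s in nhds s. 0 = (max 0 (s - a)) ^ Suc (Suc k)"
    using eventually_nhds_in_open[of "{..<a}" s] less by (auto elim!: eventually_mono)
  ultimately show ?thesis using less by (subst (asm) DERIV_cong_ev[OF refl _ refl]) auto
next
  case equal
  have "((\<lambda>h. (max 0 h) ^ Suc (Suc k) / h) \<longlongrightarrow> (0::real)) (at 0)"
  proof (rule Lim_null_comparison[OF _ tendsto_eq_rhs])
    show "\<forall>\<^sub>F h::real in at 0. norm ((max 0 h) ^ Suc (Suc k) / h) \<le> \<bar>h\<bar> ^ Suc k"
    proof (intro always_eventually allI)
      fix h :: real
      show "norm ((max 0 h) ^ Suc (Suc k) / h) \<le> \<bar>h\<bar> ^ Suc k"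
        by (cases "h \<le> 0") (simp_all add: max_def del: power_Suc, simp)
    qed
    show "((\<lambda>h::real. \<bar>h\<bar> ^ Suc k) \<longlongrightarrow> \<bar>0\<bar> ^ Suc k) (at 0)" by (intro tendsto_intros)
  qed simp
  then show ?thesis using equal by (simp add: DERIV_def)
next
  case greater
  have "((\<lambda>s::real. (s - a) ^ Suc (Suc k)) has_real_derivative real (Suc (Suc k)) * (s - a) ^ Suc k) (at s)"
    by (rule DERIV_cong[OF DERIV_power[where n = "Suc (Suc k)", OF DERIV_diff[OF DERIV_ident DERIV_const]]])
      (simp del: power_Suc)
  moreover have "\<forall>\<^sub>F s in nhds s. (s - a) ^ Suc (Suc k) = (max 0 (s - a)) ^ Suc (Suc k)"
    using eventually_nhds_in_open[of "{a<..}" s] greater by (auto elim!: eventually_mono)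
  ultimately show ?thesis using greater by (subst (asm) DERIV_cong_ev[OF refl _ refl]) auto
qed

lemma DERIV_pos_part_square: "((\<lambda>s::real. (max 0 (s - a))\<^sup>2) has_real_derivative 2 * max 0 (s - a)) (at s)"
  using DERIV_pos_part_power[of a 0 s] by (simp add: numeral_2_eq_2)

lemma DERIV_pos_part_cube: "((\<lambda>s::real. (max 0 (s - a)) ^ 3) has_real_derivative 3 * (max 0 (s - a))\<^sup>2) (at s)"
  using DERIV_pos_part_power[of a 1 s] by (simp add: numeral_2_eq_2 numeral_3_eq_3)

text \<open>
  The quadratic polynomial in \<open>s\<close> is, up to a factor, the antiderivative of \<open>\<vartheta>\<close> beyond \<open>P\<close>. The
  hypotheses say that \<open>\<vartheta>\<close> descends to \<open>- l/2\<close> at \<open>Q\<close>, returns to 0 at \<open>P\<close> with slope \<open>\<kappa>\<close>, and that its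
  positive and negative parts have the same integral.
\<close>

lemma theta_integral_vanishes:
  fixes R l lq \<kappa> P Q s :: real
  assumes "2 * \<kappa> * (P - Q) = l" "2 * lq * Q = l + 2 * lq + 2 * lq * R"
    "l * P = 2 * lq + 4 * lq * R + l + l * R"
  shows "2 * (2 * lq * s - lq * (s - R)\<^sup>2 + (lq + \<kappa>) * (s - Q)\<^sup>2 - \<kappa> * (s - P)\<^sup>2) = 0"
proof -
  \<comment> \<open>The left-hand side as a combination of the three relations, with polynomial coefficients.\<close>
  have "2 * (2 * lq * s - lq * (s - R)\<^sup>2 + (lq + \<kappa>) * (s - Q)\<^sup>2 - \<kappa> * (s - P)\<^sup>2) =
      (2 * \<kappa> * (P - Q) - l) * (2 * s - P - Q)
      + (2 * lq * Q - (l + 2 * lq + 2 * lq * R)) * (Q + 1 + R - 2 * s)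
      - (l * P - (2 * lq + 4 * lq * R + l + l * R))"
    by (simp add: power2_eq_square algebra_simps)
  then show ?thesis unfolding assms by simp
qed

context
  fixes R l lq :: real
  assumes R: "R > 0" and l: "l > 0" and lq: "lq > 0" and QP: "const_Q R l lq < const_P R l lq"
begin

lemma lq_const_Q: "lq * const_Q R l lq = l / 2 + lq + lq * R"
  using lq by (simp add: const_Q_def field_simps)

lemma l_const_P: "l * const_P R l lq = 2 * lq + 4 * lq * R + l + l * R"
  using l by (simp add: const_P_def field_simps)

lemma denominator: "4 * lq\<^sup>2 + 8 * lq\<^sup>2 * R - l\<^sup>2 = 2 * l * lq * (const_P R l lq - const_Q R l lq)"
  using l lq by (simp add: const_P_def const_Q_def field_simps power2_eq_square)

lemma denominator_pos: "2 * l * lq * (const_P R l lq - const_Q R l lq) > 0"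
  using l lq QP by simp

lemma slope_eq: "theta_slope R l lq * (const_P R l lq - const_Q R l lq) = l / 2"
  unfolding theta_slope_def denominator using l lq QP by (simp add: field_simps power2_eq_square)

lemma slope_pos: "theta_slope R l lq > 0"
  unfolding theta_slope_def denominator by (rule divide_pos_pos[OF _ denominator_pos]) (use l lq in simp)

lemma R_less_const_Q: "R + 1 < const_Q R l lq" using l lq by (simp add: const_Q_def)

lemma theta_pos_parts:
  "theta R l lq r = lq - lq * max 0 (r - R) + (lq + theta_slope R l lq) * max 0 (r - const_Q R l lq) - theta_slope R l lq * max 0 (r - const_P R l lq)"
proof -
  have "2 * lq\<^sup>2 * l + 4 * lq\<^sup>2 * l * R + lq * l\<^sup>2 + lq * l\<^sup>2 * R = lq * l * (l * const_P R l lq)"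
    unfolding l_const_P by (simp add: algebra_simps power2_eq_square)
  then have c: "lq * l\<^sup>2 * r / (4 * lq\<^sup>2 + 8 * lq\<^sup>2 * R - l\<^sup>2)
        - (2 * lq\<^sup>2 * l + 4 * lq\<^sup>2 * l * R + lq * l\<^sup>2 + lq * l\<^sup>2 * R) / (4 * lq\<^sup>2 + 8 * lq\<^sup>2 * R - l\<^sup>2)
      = theta_slope R l lq * r - theta_slope R l lq * const_P R l lq"
    by (simp add: theta_slope_def power2_eq_square)
  have k: "theta_slope R l lq * const_P R l lq = l / 2 + theta_slope R l lq * const_Q R l lq" using slope_eq by (simp add: algebra_simps)
  consider "r \<le> R" | "R < r" "r \<le> const_Q R l lq" | "const_Q R l lq < r" "r \<le> const_P R l lq" | "const_P R l lq < r"
    by linarith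
  then show ?thesis
  proof cases
    case 1
    then show ?thesis using R_less_const_Q QP by (simp add: theta_def max_def)
  next
    case 2
    then show ?thesis using QP by (simp add: theta_def max_def right_diff_distrib)
  next
    case 3
    then have "theta R l lq r = theta_slope R l lq * r - theta_slope R l lq * const_P R l lq"
      unfolding theta_def c using R_less_const_Q by simp
    moreover have "max 0 (r - R) = r - R" "max 0 (r - const_Q R l lq) = r - const_Q R l lq" "max 0 (r - const_P R l lq) = 0"
      using 3 R_less_const_Q by simp_all
    ultimately show ?thesis using k lq_const_Q by (simp add: right_diff_distrib distrib_right)
  next
    case 4
    then have "theta R l lq r = 0" using R_less_const_Q QP by (simp add: theta_def)
    moreover have "max 0 (r - R) = r - R" "max 0 (r - const_Q R l lq) = r - const_Q R l lq" "max 0 (r - const_P R l lq) = r - const_P R l lq"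
      using 4 R_less_const_Q QP by simp_all
    ultimately show ?thesis using k lq_const_Q by (simp add: right_diff_distrib distrib_right)
  qed
qed

lemma DERIV_psi_bar_deriv: "(psi_bar_deriv R l lq has_real_derivative theta R l lq s) (at s)"
  unfolding psi_bar_deriv_def[abs_def] theta_pos_parts
  by (rule DERIV_cong[OF DERIV_diff[OF DERIV_add[OF DERIV_diff[OF DERIV_cmult_Id]]]],
      (rule DERIV_cdivide[OF DERIV_cmult[OF DERIV_pos_part_square]])+) simp

lemma DERIV_psi_bar_formula: "(psi_bar_formula R l lq has_real_derivative psi_bar_deriv R l lq s) (at s)"
  unfolding psi_bar_formula_def[abs_def] psi_bar_deriv_def
  by (rule DERIV_cong[OF DERIV_diff[OF DERIV_add[OF DERIV_diff[OF DERIV_cdivide[OF DERIV_cmult[OF DERIV_pow]]]]]],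
      (rule DERIV_cdivide[OF DERIV_cmult[OF DERIV_pos_part_cube]])+) simp

lemma integral_theta: "s \<ge> 0 \<Longrightarrow> integral {0..s} (theta R l lq) = psi_bar_deriv R l lq s"
proof -
  assume "s \<ge> 0"
  then have "(theta R l lq has_integral (psi_bar_deriv R l lq s - psi_bar_deriv R l lq 0)) {0..s}"
    using DERIV_psi_bar_deriv by (intro fundamental_theorem_of_calculus)
      (auto simp: has_real_derivative_iff_has_vector_derivative[symmetric] intro: has_field_derivative_at_within)
  moreover have "psi_bar_deriv R l lq 0 = 0" using R R_less_const_Q QP by (simp add: psi_bar_deriv_def max_def)
  ultimately show ?thesis by (simp add: integral_unique)
qed

lemma psi_bar_eq: "t \<ge> 0 \<Longrightarrow> psi_bar R l lq t = psi_bar_formula R l lq t"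
proof -
  assume "t \<ge> 0"
  then have "(psi_bar_deriv R l lq has_integral (psi_bar_formula R l lq t - psi_bar_formula R l lq 0)) {0..t}"
    using DERIV_psi_bar_formula by (intro fundamental_theorem_of_calculus)
      (auto simp: has_real_derivative_iff_has_vector_derivative[symmetric] intro: has_field_derivative_at_within)
  moreover have "psi_bar_formula R l lq 0 = 0" using R R_less_const_Q QP by (simp add: psi_bar_formula_def max_def)
  moreover have "psi_bar R l lq t = integral {0..t} (psi_bar_deriv R l lq)"
    using lq by (auto simp: psi_bar_def integral_theta intro!: integral_cong)
  ultimately show ?thesis by (simp add: integral_unique)
qed

lemma theta_ge: "theta R l lq r \<ge> - l / 2"
proof -
  consider "r \<le> R" | "R < r" "r \<le> const_Q R l lq" | "const_Q R l lq < r" "r \<le> const_P R l lq" | "const_P R l lq < r" by linarith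
  then show ?thesis
  proof cases
    case 2
    then have "lq * r \<le> lq * const_Q R l lq" using lq by simp
    then show ?thesis using 2 lq_const_Q by (simp add: theta_def)
  next
    case 3
    then have "theta_slope R l lq * (const_P R l lq - r) \<le> theta_slope R l lq * (const_P R l lq - const_Q R l lq)" using slope_pos by simp
    then show ?thesis using 3 R_less_const_Q lq_const_Q slope_eq unfolding theta_pos_parts
      by (simp add: max_def algebra_simps)
  qed (use l lq R_less_const_Q QP in \<open>auto simp: theta_def\<close>)
qed

lemma theta_nonneg: "r \<le> R + 1 \<Longrightarrow> theta R l lq r \<ge> 0"
proof -
  assume "r \<le> R + 1"
  then have "lq * r \<le> lq * (R + 1)" using lq by simp
  then show ?thesis using \<open>r \<le> R + 1\<close> lq R_less_const_Q by (simp add: theta_def algebra_simps)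
qed

lemma theta_nonpos: "r \<ge> R + 1 \<Longrightarrow> theta R l lq r \<le> 0"
proof -
  assume r: "r \<ge> R + 1"
  then have "lq * r \<ge> lq * (R + 1)" using lq by simp
  moreover have "theta_slope R l lq * (const_P R l lq - r) \<ge> 0" if "r \<le> const_P R l lq" using slope_pos that by simp
  ultimately show ?thesis using r R_less_const_Q QP lq_const_Q slope_eq unfolding theta_pos_parts
    by (auto simp: max_def algebra_simps)
qed

lemma psi_bar_deriv_eq_0: "s \<ge> const_P R l lq \<Longrightarrow> psi_bar_deriv R l lq s = 0"
proof -
  assume s: "s \<ge> const_P R l lq"
  have "2 * psi_bar_deriv R l lq s = 2 * lq * s - lq * (s - R)\<^sup>2 + (lq + theta_slope R l lq) * (s - const_Q R l lq)\<^sup>2 - theta_slope R l lq * (s - const_P R l lq)\<^sup>2"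
    using s R_less_const_Q QP by (simp add: psi_bar_deriv_def max_def field_simps)
  also have "\<dots> = 0"
    using theta_integral_vanishes[of "theta_slope R l lq" "const_P R l lq" "const_Q R l lq" l lq R s] slope_eq lq_const_Q l_const_P by (simp add: mult.assoc)
  finally show ?thesis by simp
qed

lemma psi_bar_deriv_nonneg: "s \<ge> 0 \<Longrightarrow> psi_bar_deriv R l lq s \<ge> 0"
proof (cases "s \<le> R + 1")
  case True
  assume "s \<ge> 0"
  then have "psi_bar_deriv R l lq 0 \<le> psi_bar_deriv R l lq s"
    by (rule DERIV_nonneg_imp_nondecreasing) (use True theta_nonneg DERIV_psi_bar_deriv in force)
  moreover have "psi_bar_deriv R l lq 0 = 0" using R R_less_const_Q QP by (simp add: psi_bar_deriv_def max_def)
  ultimately show ?thesis by simp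
next
  case False
  have "psi_bar_deriv R l lq (max s (const_P R l lq)) \<le> psi_bar_deriv R l lq s"
    by (rule DERIV_nonpos_imp_nonincreasing) (use False theta_nonpos DERIV_psi_bar_deriv in force)+
  then show ?thesis by (simp add: psi_bar_deriv_eq_0)
qed

lemma psi_bar_deriv_le: "s \<ge> 0 \<Longrightarrow> psi_bar_deriv R l lq s \<le> lq * const_P R l lq"
proof (cases "s \<le> const_P R l lq")
  case True
  assume s: "s \<ge> 0"
  have th: "theta R l lq r \<le> lq" if "r \<ge> 0" for r
    using theta_nonpos[of r] lq R_less_const_Q by (cases "r \<le> R + 1") (auto simp: theta_def)
  have "psi_bar_deriv R l lq s - lq * s \<le> psi_bar_deriv R l lq 0 - lq * 0"
  proof (rule DERIV_nonpos_imp_nonincreasing[OF s, where f = "\<lambda>s. psi_bar_deriv R l lq s - lq * s"])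
    fix r assume "0 \<le> r" "r \<le> s"
    moreover have "((\<lambda>s. psi_bar_deriv R l lq s - lq * s) has_real_derivative theta R l lq r - lq) (at r)"
      by (auto intro!: derivative_eq_intros DERIV_psi_bar_deriv)
    ultimately show "\<exists>y. ((\<lambda>s. psi_bar_deriv R l lq s - lq * s) has_real_derivative y) (at r) \<and> y \<le> 0"
      using th[of r] by fastforce
  qed
  moreover have "psi_bar_deriv R l lq 0 = 0" using R R_less_const_Q QP by (simp add: psi_bar_deriv_def max_def)
  moreover have "lq * s \<le> lq * const_P R l lq" using True lq by simp
  ultimately show ?thesis by simp
qed (use lq R_less_const_Q QP R in \<open>simp add: psi_bar_deriv_eq_0\<close>)

lemma psi_bar_formula_tangent:
  "psi_bar_formula R l lq t \<ge> psi_bar_formula R l lq s + psi_bar_deriv R l lq s * (t - s) - l / 4 * (t - s)\<^sup>2"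
proof -
  let ?g = "\<lambda>t. psi_bar_formula R l lq t + l / 4 * t\<^sup>2"
  have d1: "(?g has_real_derivative psi_bar_deriv R l lq t + l / 2 * t) (at t)" for t
    by (auto intro!: derivative_eq_intros DERIV_psi_bar_formula)
  have d2: "((\<lambda>t. psi_bar_deriv R l lq t + l / 2 * t) has_real_derivative theta R l lq t + l / 2) (at t)" for t
    by (auto intro!: derivative_eq_intros DERIV_psi_bar_deriv)
  have "convex_on UNIV ?g"
  proof (rule f''_ge0_imp_convex[OF _ d1 d2])
    show "0 \<le> theta R l lq t + l / 2" for t using theta_ge[of t] by simp
  qed simp
  from convex_on_imp_above_tangent[OF this, of s t "psi_bar_deriv R l lq s + l / 2 * s"]
  have "psi_bar_formula R l lq t + l / 4 * t\<^sup>2 - (psi_bar_formula R l lq s + l / 4 * s\<^sup>2) \<ge> (psi_bar_deriv R l lq s + l / 2 * s) * (t - s)"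
    using d1[of s] by (simp add: has_field_derivative_at_within)
  then show ?thesis by (simp add: power2_eq_square algebra_simps diff_divide_distrib)
qed

lemma psi_bar_formula_mono: "0 \<le> s \<Longrightarrow> s \<le> t \<Longrightarrow> psi_bar_formula R l lq s \<le> psi_bar_formula R l lq t"
  by (rule DERIV_nonneg_imp_nondecreasing) (use psi_bar_deriv_nonneg DERIV_psi_bar_formula in force)+

lemma psi_bar_formula_le: "t \<ge> 0 \<Longrightarrow> psi_bar_formula R l lq t \<le> lq * (const_P R l lq)\<^sup>2"
proof -
  assume t: "t \<ge> 0"
  have P0: "const_P R l lq > 0" using R R_less_const_Q QP by simp
  have "psi_bar_formula R l lq t \<le> psi_bar_formula R l lq (max t (const_P R l lq))" using t by (intro psi_bar_formula_mono) auto
  also have "\<dots> \<le> psi_bar_formula R l lq (const_P R l lq)"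
    by (rule DERIV_nonpos_imp_nonincreasing) (use psi_bar_deriv_eq_0 DERIV_psi_bar_formula in \<open>force simp: \<close>)+
  also have "\<dots> \<le> psi_bar_formula R l lq 0 - lq * const_P R l lq * 0 + lq * const_P R l lq * const_P R l lq"
  proof -
    have "psi_bar_formula R l lq (const_P R l lq) - lq * const_P R l lq * const_P R l lq \<le> psi_bar_formula R l lq 0 - lq * const_P R l lq * 0"
    proof (rule DERIV_nonpos_imp_nonincreasing[where f = "\<lambda>s. psi_bar_formula R l lq s - lq * const_P R l lq * s"])
      fix r assume "0 \<le> r" "r \<le> const_P R l lq"
      moreover have "((\<lambda>s. psi_bar_formula R l lq s - lq * const_P R l lq * s) has_real_derivative psi_bar_deriv R l lq r - lq * const_P R l lq) (at r)"
        by (auto intro!: derivative_eq_intros DERIV_psi_bar_formula)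
      ultimately show "\<exists>y. ((\<lambda>s. psi_bar_formula R l lq s - lq * const_P R l lq * s) has_real_derivative y) (at r) \<and> y \<le> 0"
        using psi_bar_deriv_le[of r] by fastforce
    qed (use P0 in simp)
    then show ?thesis by simp
  qed
  also have "psi_bar_formula R l lq 0 = 0" using R R_less_const_Q QP by (simp add: psi_bar_formula_def max_def)
  finally show ?thesis by (simp add: power2_eq_square)
qed

lemma psi_bar_formula_quadratic: "t \<le> R \<Longrightarrow> psi_bar_formula R l lq t = lq * t\<^sup>2 / 2"
  using R_less_const_Q QP by (simp add: psi_bar_formula_def max_def)

end

text \<open>
  The bound \<open>\<vartheta> \<ge> - \<lambda>/2\<close> enters as a parabola of opening \<open>\<lambda>/4\<close> below the graph of \<open>psi_bar\<close>, which is
  the form in which a touching function is read off from it.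
\<close>

lemma psi_bar_properties:
  assumes R: "R > 0" and l: "l > 0" and lq: "lq \<ge> 0" and wd: "theta_well_defined R l lq"
  shows "t \<ge> 0 \<Longrightarrow> 0 \<le> psi_bar_deriv R l lq t"
    and "t \<ge> 0 \<Longrightarrow> psi_bar_deriv R l lq t \<le> lq * const_P R l lq"
    and "t \<ge> const_P R l lq \<Longrightarrow> psi_bar_deriv R l lq t = 0"
    and "0 \<le> s \<Longrightarrow> 0 \<le> t \<Longrightarrow>
      psi_bar R l lq s + psi_bar_deriv R l lq s * (t - s) - l / 4 * (t - s)\<^sup>2 \<le> psi_bar R l lq t"
    and "0 \<le> s \<Longrightarrow> s \<le> t \<Longrightarrow> psi_bar R l lq s \<le> psi_bar R l lq t"
    and "0 \<le> t \<Longrightarrow> t \<le> R \<Longrightarrow> psi_bar R l lq t = lq * t\<^sup>2 / 2"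
    and "0 \<le> t \<Longrightarrow> psi_bar R l lq t \<le> lq * (const_P R l lq)\<^sup>2"
proof -
  have pos: "lq > 0 \<and> const_Q R l lq < const_P R l lq" if "lq \<noteq> 0"
    using lq wd that by (auto simp: theta_well_defined_def)
  have zero: "psi_bar R l 0 t = 0" "psi_bar_deriv R l 0 t = 0" for t
    by (simp_all add: psi_bar_def psi_bar_deriv_def theta_slope_def)
  show "t \<ge> 0 \<Longrightarrow> 0 \<le> psi_bar_deriv R l lq t"
    using pos psi_bar_deriv_nonneg[OF R l] by (cases "lq = 0") (auto simp: zero)
  show "t \<ge> 0 \<Longrightarrow> psi_bar_deriv R l lq t \<le> lq * const_P R l lq"
    using pos psi_bar_deriv_le[OF R l] by (cases "lq = 0") (auto simp: zero)
  show "t \<ge> const_P R l lq \<Longrightarrow> psi_bar_deriv R l lq t = 0"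
    using pos psi_bar_deriv_eq_0[OF R l] by (cases "lq = 0") (auto simp: zero)
  show "0 \<le> s \<Longrightarrow> 0 \<le> t \<Longrightarrow>
      psi_bar R l lq s + psi_bar_deriv R l lq s * (t - s) - l / 4 * (t - s)\<^sup>2 \<le> psi_bar R l lq t"
    using pos psi_bar_formula_tangent[OF R l] psi_bar_eq[OF R l] l by (cases "lq = 0") (auto simp: zero)
  show "0 \<le> s \<Longrightarrow> s \<le> t \<Longrightarrow> psi_bar R l lq s \<le> psi_bar R l lq t"
    using pos psi_bar_formula_mono[OF R l] psi_bar_eq[OF R l] by (cases "lq = 0") (auto simp: zero)
  show "0 \<le> t \<Longrightarrow> t \<le> R \<Longrightarrow> psi_bar R l lq t = lq * t\<^sup>2 / 2"
    using pos psi_bar_formula_quadratic[OF R l] psi_bar_eq[OF R l] by (cases "lq = 0") (auto simp: zero)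
  show "0 \<le> t \<Longrightarrow> psi_bar R l lq t \<le> lq * (const_P R l lq)\<^sup>2"
    using pos psi_bar_formula_le[OF R l] psi_bar_eq[OF R l] by (cases "lq = 0") (auto simp: zero)
qed

section \<open>The logarithm of the Hessian determinant along a line\<close>

abbreviation hess :: "((nat \<Rightarrow> real) \<Rightarrow> real) \<Rightarrow> (nat \<Rightarrow> real) \<Rightarrow> nat \<Rightarrow> nat \<Rightarrow> real" where
  "hess f x \<equiv> \<lambda>i j. partial i (partial j f) x"

lemma bilin_hess: "smooth_Rn n f \<Longrightarrow> x \<in> Rn n \<Longrightarrow> bilin n (hess f x) u v = dir_deriv n u (dir_deriv n v f) x"
  by (simp add: bilin_def dir_deriv_dir_deriv)

lemma dir_deriv_of_sum:
  assumes "finite I" "\<And>a. a \<in> I \<Longrightarrow> smooth_Rn n (F a)" "x \<in> Rn n"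
  shows "dir_deriv n w (\<lambda>x. \<Sum>a\<in>I. c a * F a x) x = (\<Sum>a\<in>I. c a * dir_deriv n w (F a) x)"
proof -
  have "partial i (\<lambda>x. \<Sum>a\<in>I. c a * F a x) x = (\<Sum>a\<in>I. c a * partial i (F a) x)" if "i < n" for i
    using assms that by (intro partial_sum) auto
  then have "dir_deriv n w (\<lambda>x. \<Sum>a\<in>I. c a * F a x) x = (\<Sum>i<n. \<Sum>a\<in>I. w i * (c a * partial i (F a) x))"
    by (simp add: dir_deriv_def sum_distrib_left)
  also have "\<dots> = (\<Sum>a\<in>I. \<Sum>i<n. w i * (c a * partial i (F a) x))" by (rule sum.swap)
  finally show ?thesis by (simp add: dir_deriv_def sum_distrib_left mult_ac)
qed

text \<open>
  By the midpoint inequality \<open>f(x + tu) + f(x - tu)\<close> is minimal at \<open>t = 0\<close>.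
\<close>

lemma convex_imp_psd:
  assumes f: "smooth_Rn n f" and cv: "convex_fun_Rn n f" and x: "x \<in> Rn n"
  shows "dir_deriv n u (dir_deriv n u f) x \<ge> 0"
proof -
  define v where "v = (\<lambda>i. (-1) * u i)"
  have dv: "dir_deriv n v g y = - dir_deriv n u g y" for g y unfolding v_def dir_deriv_scale by simp
  let ?g = "\<lambda>t. - (f (line n x u t) + f (line n x v t))"
  have g1: "(?g has_real_derivative - (dir_deriv n u f (line n x u t) + dir_deriv n v f (line n x v t))) (at t)" for t
    by (intro DERIV_minus DERIV_add dir_deriv_line f)
  have g2: "((\<lambda>t. - (dir_deriv n u f (line n x u t) + dir_deriv n v f (line n x v t))) has_real_derivative
      - (dir_deriv n u (dir_deriv n u f) (line n x u 0) + dir_deriv n v (dir_deriv n v f) (line n x v 0))) (at 0)"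
    by (intro DERIV_minus DERIV_add dir_deriv_line smooth_dir_deriv f)
  have le: "?g t \<le> ?g 0" for t
  proof -
    have "f (\<lambda>i\<in>{..<n}. (1 - 1/2) * line n x u t i + 1/2 * line n x v t i)
        \<le> (1 - 1/2) * f (line n x u t) + 1/2 * f (line n x v t)"
      by (rule cv[unfolded convex_fun_Rn_def, rule_format, OF line_Rn line_Rn]) simp
    also have "(\<lambda>i\<in>{..<n}. (1 - 1/2) * line n x u t i + 1/2 * line n x v t i) = x"
      by (rule Rn_eqI[OF restrict_Rn x]) (simp add: line_def v_def field_simps)
    finally show ?thesis using x by simp
  qed
  have "- (dir_deriv n u (dir_deriv n u f) (line n x u 0) + dir_deriv n v (dir_deriv n v f) (line n x v 0)) \<le> 0"
    by (rule local_max_second_derivative(2)[OF g1 g2]) (simp only: le eventually_True)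
  moreover have "dir_deriv n v (dir_deriv n v f) x = dir_deriv n u (dir_deriv n u f) x"
    unfolding v_def dir_deriv_dir_deriv[OF f x] by simp
  ultimately show ?thesis using x by simp
qed

lemma convex_imp_pos_def:
  assumes f: "smooth_Rn n f" and cv: "convex_fun_Rn n f" and x: "x \<in> Rn n"
    and det: "Determinant.det (hessian n f x) \<noteq> 0"
  shows "pos_def n (hess f x)"
proof (rule pos_def_of_psd)
  show "hess f x i j = hess f x j i" if "i < n" "j < n" for i j by (rule partial_commute[OF f that x])
  show "bilin n (hess f x) v v \<ge> 0" for v by (simp add: bilin_hess[OF f x] convex_imp_psd[OF f cv x])
  show "Determinant.det (fmat n (hess f x)) \<noteq> 0" using det by (simp add: hessian_def)
qed

text \<open>
  Along the line through \<open>x0\<close> in direction \<open>w\<close>, Hadamard's inequality for the frame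
  \<open>v i - t (s i) (v 0)\<close> bounds \<open>ln det D\<^sup>2\<phi>\<close> by its value at \<open>x0\<close> plus \<open>\<Sum>\<^sub>i ln (q i t)\<close>, where
  \<open>q i t\<close> is the Hessian form at the i-th frame vector. Equality holds at \<open>t = 0\<close>, where all
  \<open>q i\<close> equal 1. So the first derivatives agree there and the second derivatives are ordered.
\<close>

lemma log_det_comparison:
  assumes \<phi>: "smooth_Rn n \<phi>" and n: "0 < n" and x0: "x0 \<in> Rn n"
    and det: "\<And>x. x \<in> Rn n \<Longrightarrow> Determinant.det (hessian n \<phi> x) > 0"
    and pd: "\<And>x. x \<in> Rn n \<Longrightarrow> pos_def n (hess \<phi> x)"
    and v: "\<And>i j. i < n \<Longrightarrow> j < n \<Longrightarrow> bilin n (hess \<phi> x0) (v i) (v j) = (if i = j then 1 else 0)"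
    and s: "s 0 = 0"
    and F1: "\<And>t. ((\<lambda>t. ln (Determinant.det (hessian n \<phi> (line n x0 w t)))) has_real_derivative F' t) (at t)"
    and F2: "(F' has_real_derivative F2) (at 0)"
  shows "F' 0 = (\<Sum>i<n. dir_deriv n w (dir_deriv n (v i) (dir_deriv n (v i) \<phi>)) x0)"
    and "F2 \<le> (\<Sum>i<n. dir_deriv n w (dir_deriv n w (dir_deriv n (v i) (dir_deriv n (v i) \<phi>))) x0
                 - 4 * s i * dir_deriv n w (dir_deriv n (v i) (dir_deriv n (v 0) \<phi>)) x0 + 2 * (s i)\<^sup>2
                 - (dir_deriv n w (dir_deriv n (v i) (dir_deriv n (v i) \<phi>)) x0)\<^sup>2)"
proof -
  let ?X = "line n x0 w"
  define A where "A i j = dir_deriv n (v i) (dir_deriv n (v j) \<phi>)" for i j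
  define A' where "A' i j = dir_deriv n w (A i j)" for i j
  define A'' where "A'' i j = dir_deriv n w (A' i j)" for i j
  have smA: "smooth_Rn n (A i j)" and smA': "smooth_Rn n (A' i j)" for i j
    unfolding A_def A'_def by (intro smooth_dir_deriv \<phi>)+
  have dA: "((\<lambda>t. A i j (?X t)) has_real_derivative A' i j (?X t)) (at t)" for i j t
    unfolding A'_def by (rule dir_deriv_line[OF smA])
  have dA': "((\<lambda>t. A' i j (?X t)) has_real_derivative A'' i j (?X t)) (at t)" for i j t
    unfolding A''_def by (rule dir_deriv_line[OF smA'])
  define g where "g t i = (\<lambda>k. 1 * v i k + (- t * s i) * v 0 k)" for t i
  \<comment> \<open>The form at the sheared vector, expanded; A i j is the function with values D v_i D v_j phi.\<close>
  define q where "q i t = A i i (?X t) - 2 * s i * (t * A i 0 (?X t)) + (s i)\<^sup>2 * (t\<^sup>2 * A 0 0 (?X t))" for i t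
  define q' where "q' i t = A' i i (?X t) - 2 * s i * (A i 0 (?X t) + t * A' i 0 (?X t))
     + (s i)\<^sup>2 * (2 * t * A 0 0 (?X t) + t\<^sup>2 * A' 0 0 (?X t))" for i t
  define q'' where "q'' i = A'' i i x0 - 4 * s i * A' i 0 x0 + 2 * (s i)\<^sup>2 * A 0 0 x0" for i
  have A0: "A i j x0 = (if i = j then 1 else 0)" if "i < n" "j < n" for i j
    using v[OF that] by (simp add: bilin_hess[OF \<phi> x0] A_def)
  have sA: "s i * A i 0 x0 = 0" if "i < n" for i using A0[OF that n] s by (cases "i = 0") auto
  have q_bil: "q i t = bilin n (hess \<phi> (?X t)) (g t i) (g t i)" for i t
  proof -
    have "bilin n (hess \<phi> (?X t)) (v i) (v 0) = bilin n (hess \<phi> (?X t)) (v 0) (v i)"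
      by (rule bilin_commute[OF pd]) simp
    then show ?thesis
      unfolding g_def bilin_lincomb_left bilin_lincomb_right
      by (simp add: q_def A_def bilin_hess[OF \<phi>, symmetric] power2_eq_square algebra_simps)
  qed
  have q_pos: "q i t > 0" if i: "i < n" for i t
  proof -
    have "bilin n (hess \<phi> x0) (v i) (g t i) = A i i x0 - t * (s i * A i 0 x0)"
      unfolding g_def bilin_lincomb_right by (simp add: bilin_hess[OF \<phi> x0] A_def)
    also have "\<dots> = 1" using sA[OF i] A0[OF i i] by simp
    finally have "\<exists>k<n. g t i k \<noteq> 0" by (auto simp: bilin_def) (metis (no_types, lifting) lessThan_iff mult_eq_0_iff sum.neutral zero_neq_one)
    then show ?thesis unfolding q_bil using pd[of "?X t"] by (auto simp: pos_def_def)
  qed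
  have q0: "q i 0 = 1" "q' i 0 = A' i i x0" if "i < n" for i
    using that A0[OF that that] sA[OF that] x0 by (simp_all add: q_def q'_def)
  have dq: "(q i has_real_derivative q' i t) (at t)" for i t
    unfolding q_def[abs_def] q'_def
    by (rule DERIV_cong[OF DERIV_add[OF DERIV_diff[OF dA DERIV_cmult[OF DERIV_mult[OF DERIV_ident dA]]]
          DERIV_cmult[OF DERIV_mult[OF DERIV_power[OF DERIV_ident] dA]]]]) (simp add: algebra_simps)
  have dq': "(q' i has_real_derivative q'' i) (at 0)" for i
    unfolding q'_def[abs_def] q''_def
    by (rule DERIV_cong[OF DERIV_add[OF DERIV_diff[OF dA' DERIV_cmult[OF DERIV_add[OF dA DERIV_mult[OF DERIV_ident dA']]]]
          DERIV_cmult[OF DERIV_add[OF DERIV_mult[OF DERIV_cmult_Id dA] DERIV_mult[OF DERIV_power[OF DERIV_ident] dA']]]]])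
      (simp add: x0 algebra_simps)
  let ?k = "\<lambda>t. ln (Determinant.det (hessian n \<phi> (?X t))) - (\<Sum>i<n. ln (q i t))"
  let ?k' = "\<lambda>t. F' t - (\<Sum>i<n. q' i t / q i t)"
  have k1: "(?k has_real_derivative ?k' t) (at t)" for t
    by (intro DERIV_diff F1 DERIV_sum) (auto intro!: derivative_eq_intros dq q_pos)
  have k2: "(?k' has_real_derivative F2 - (\<Sum>i<n. q'' i - (A' i i x0)\<^sup>2)) (at 0)"
  proof (intro DERIV_diff F2 DERIV_sum)
    fix i assume "i \<in> {..<n}"
    then have i: "i < n" by simp
    show "((\<lambda>t. q' i t / q i t) has_real_derivative q'' i - (A' i i x0)\<^sup>2) (at 0)"
      by (rule DERIV_cong[OF DERIV_divide[OF dq' dq]]) (simp_all add: q0[OF i] power2_eq_square)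
  qed
  have le: "?k t \<le> ?k 0" for t
  proof -
    have "Determinant.det (fmat n (hess \<phi> (?X t))) \<le> Determinant.det (fmat n (hess \<phi> x0)) *
        (\<Prod>i<n. bilin n (hess \<phi> (?X t)) (g t i) (g t i))"
      unfolding g_def by (rule det_le_sheared_frame[where s = "\<lambda>i. - t * s i", OF v pd]) (auto simp: s)
    then have "Determinant.det (hessian n \<phi> (?X t)) \<le> Determinant.det (hessian n \<phi> x0) * (\<Prod>i<n. q i t)"
      unfolding q_bil hessian_def .
    then have "ln (Determinant.det (hessian n \<phi> (?X t))) \<le> ln (Determinant.det (hessian n \<phi> x0) * (\<Prod>i<n. q i t))"
      using det[of "?X t"] by (intro ln_mono) simp_all
    also have "\<dots> = ln (Determinant.det (hessian n \<phi> x0)) + ln (\<Prod>i<n. q i t)"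
      using det[OF x0] q_pos by (intro ln_mult_pos prod_pos) auto
    also have "ln (\<Prod>i<n. q i t) = (\<Sum>i<n. ln (q i t))"
      by (intro ln_prod) (auto simp: less_imp_neq[OF q_pos, symmetric])
    finally show ?thesis using x0 by (simp add: q0)
  qed
  have "?k' 0 = 0" "F2 - (\<Sum>i<n. q'' i - (A' i i x0)\<^sup>2) \<le> 0"
    by (rule local_max_second_derivative[OF k1 k2], simp only: le eventually_True)+
  moreover have "q'' i = A'' i i x0 - 4 * s i * A' i 0 x0 + 2 * (s i)\<^sup>2" for i
    using A0[OF n n] by (simp add: q''_def)
  ultimately show "F' 0 = (\<Sum>i<n. dir_deriv n w (dir_deriv n (v i) (dir_deriv n (v i) \<phi>)) x0)"
    and "F2 \<le> (\<Sum>i<n. dir_deriv n w (dir_deriv n w (dir_deriv n (v i) (dir_deriv n (v i) \<phi>))) x0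
                 - 4 * s i * dir_deriv n w (dir_deriv n (v i) (dir_deriv n (v 0) \<phi>)) x0 + 2 * (s i)\<^sup>2
                 - (dir_deriv n w (dir_deriv n (v i) (dir_deriv n (v i) \<phi>)) x0)\<^sup>2)"
    by (simp_all add: q0 A_def A'_def A''_def)
qed

section \<open>Second-order conditions at the maximum\<close>

lemma norm_Rn_sq: "(norm_Rn n x)\<^sup>2 = (\<Sum>i<n. (x i)\<^sup>2)"
  by (simp add: norm_Rn_def L2_set_def sum_nonneg)

lemma norm_Rn_nonneg: "norm_Rn n x \<ge> 0"
  by (simp add: norm_Rn_def)

lemma dir_deriv_restrict: "dir_deriv n (\<lambda>i\<in>{..<n}. z i) f = dir_deriv n z f"
  by (simp add: dir_deriv_def fun_eq_iff)

lemma norm_Rn_restrict: "norm_Rn n (\<lambda>i\<in>{..<n}. z i) = norm_Rn n z"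
  by (simp add: norm_Rn_def L2_set_def)

lemma hessian_geD:
  assumes "hessian_ge n c f" "smooth_Rn n f" "x \<in> Rn n"
  shows "c * (\<Sum>i<n. (z i)\<^sup>2) \<le> dir_deriv n z (dir_deriv n z f) x"
proof -
  have "c * (norm_Rn n (\<lambda>i\<in>{..<n}. z i))\<^sup>2 \<le> hessian_form n f x (\<lambda>i\<in>{..<n}. z i)"
    using assms(1,3) restrict_Rn[of z n] unfolding hessian_ge_def by blast
  then show ?thesis
    by (simp add: hessian_form_dir_deriv[OF assms(2,3)] dir_deriv_restrict norm_Rn_restrict norm_Rn_sq)
qed

lemma hessian_leD:
  assumes "hessian_le n c f" "smooth_Rn n f" "x \<in> Rn n"
  shows "dir_deriv n z (dir_deriv n z f) x \<le> c * (\<Sum>i<n. (z i)\<^sup>2)"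
proof -
  have "hessian_form n f x (\<lambda>i\<in>{..<n}. z i) \<le> c * (norm_Rn n (\<lambda>i\<in>{..<n}. z i))\<^sup>2"
    using assms(1,3) restrict_Rn[of z n] unfolding hessian_le_def by blast
  then show ?thesis
    by (simp add: hessian_form_dir_deriv[OF assms(2,3)] dir_deriv_restrict norm_Rn_restrict norm_Rn_sq)
qed

lemma dir_deriv_commute_1_2:
  assumes f: "smooth_Rn n f" and x: "x \<in> Rn n"
  shows "dir_deriv n u (dir_deriv n u (dir_deriv n v f)) x = dir_deriv n v (dir_deriv n u (dir_deriv n u f)) x"
proof -
  have "dir_deriv n u (dir_deriv n u (dir_deriv n v f)) x = dir_deriv n u (dir_deriv n v (dir_deriv n u f)) x"
    by (rule dir_deriv_cong[OF dir_deriv_commute[OF f] x])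
  also have "\<dots> = dir_deriv n v (dir_deriv n u (dir_deriv n u f)) x"
    by (rule dir_deriv_commute[OF smooth_dir_deriv[OF f] x])
  finally show ?thesis .
qed

lemma dir_deriv_commute_2_2:
  assumes f: "smooth_Rn n f" and x: "x \<in> Rn n"
  shows "dir_deriv n u (dir_deriv n u (dir_deriv n v (dir_deriv n v f))) x = dir_deriv n v (dir_deriv n v (dir_deriv n u (dir_deriv n u f))) x"
proof -
  have "dir_deriv n u (dir_deriv n u (dir_deriv n v (dir_deriv n v f))) x = dir_deriv n v (dir_deriv n u (dir_deriv n u (dir_deriv n v f))) x"
    by (rule dir_deriv_commute_1_2[OF smooth_dir_deriv[OF f] x])
  also have "\<dots> = dir_deriv n v (dir_deriv n v (dir_deriv n u (dir_deriv n u f))) x"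
    by (rule dir_deriv_cong[OF dir_deriv_commute_1_2[OF f] x])
  finally show ?thesis .
qed

lemma partial_dir_deriv: "k < n \<Longrightarrow> \<exists>e. \<forall>f. partial k f = dir_deriv n e f"
  using dir_deriv_basis by metis

text \<open>
  The gradient of \<open>V\<close> vanishes at the origin, so by the mean value theorem its component along \<open>p\<close> at
  \<open>x\<close> is a mixed second derivative \<open>D\<^sup>2V(x, p)\<close> at some point. Because \<open>D\<^sup>2V(x - p, x - p) \<ge> 0\<close>, twice
  that is at most \<open>D\<^sup>2V(x, x) + D\<^sup>2V(p, p)\<close>.
\<close>

lemma gradient_upper_bound:
  assumes V: "smooth_Rn n V" and min: "\<And>x. x \<in> Rn n \<Longrightarrow> V (origin_Rn n) \<le> V x"
    and ge: "hessian_ge n l V" "l \<ge> 0" and le: "hessian_le n L V" and x: "x \<in> Rn n"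
  shows "dir_deriv n p V x \<le> L / 2 * ((\<Sum>i<n. (x i)\<^sup>2) + (\<Sum>i<n. (p i)\<^sup>2))"
proof -
  let ?o = "origin_Rn n"
  have o: "?o \<in> Rn n" by (simp add: origin_Rn_def)
  have "((\<lambda>t. - V (line n ?o p t)) has_real_derivative - dir_deriv n p V (line n ?o p t)) (at t)" for t
    by (intro DERIV_minus dir_deriv_line V)
  then have "- dir_deriv n p V (line n ?o p 0) = 0"
    by (rule local_max_second_derivative(1)[OF _ DERIV_minus[OF dir_deriv_line[OF smooth_dir_deriv[OF V]]]])
      (simp add: o min)
  then have o0: "dir_deriv n p V ?o = 0" by (simp add: o)
  obtain s where s: "dir_deriv n p V (line n ?o x 1) - dir_deriv n p V (line n ?o x 0) = dir_deriv n x (dir_deriv n p V) (line n ?o x s) * (1 - 0)"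
    by (rule MVT_between[of "\<lambda>t. dir_deriv n p V (line n ?o x t)" _ 0 1, OF dir_deriv_line[OF smooth_dir_deriv[OF V]]])
  define y where "y = line n ?o x s"
  have y: "y \<in> Rn n" by (simp add: y_def)
  have "line n ?o x 1 = x" by (rule Rn_eqI[OF line_Rn x]) (simp add: line_def origin_Rn_def)
  then have eq: "dir_deriv n p V x = dir_deriv n x (dir_deriv n p V) y" using s o0 o by (simp add: y_def)
  let ?d = "\<lambda>i. 1 * x i + (-1) * p i"
  have "0 \<le> l * (\<Sum>i<n. (?d i)\<^sup>2)" using ge(2) by (simp add: sum_nonneg)
  also have "\<dots> \<le> dir_deriv n ?d (dir_deriv n ?d V) y" by (rule hessian_geD[OF ge(1) V y])
  also have "\<dots> = dir_deriv n x (dir_deriv n x V) y - 2 * dir_deriv n x (dir_deriv n p V) y + dir_deriv n p (dir_deriv n p V) y"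
    unfolding bilin_hess[OF V y, symmetric] bilin_lincomb_left bilin_lincomb_right
    using dir_deriv_commute[OF V y, of p x] by (simp add: bilin_hess[OF V y])
  finally show ?thesis
    unfolding eq using hessian_leD[OF le V y, of x] hessian_leD[OF le V y, of p] by (simp add: algebra_simps)
qed

lemma partial_zero_on_open:
  assumes U: "open U" and f: "\<And>x. x \<in> Rn n \<Longrightarrow> x \<in> U \<Longrightarrow> f x = 0"
    and i: "i < n" and x: "x \<in> Rn n" "x \<in> U"
  shows "partial i f x = 0"
proof -
  have "((\<lambda>t. x(i := t)) \<longlongrightarrow> x) (nhds (x i))"
  proof (rule tendsto_Rn[OF Rn_upd[OF x(1) i] x(1)])
    show "((\<lambda>t. (x(i := t)) k) \<longlongrightarrow> x k) (nhds (x i))" for k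
      by (cases "k = i") (simp_all add: filterlim_ident)
  qed
  then have "\<forall>\<^sub>F t in nhds (x i). x(i := t) \<in> U" using U x(2) by (rule topological_tendstoD)
  then have "\<forall>\<^sub>F t in nhds (x i). f (x(i := t)) = 0"
    by eventually_elim (use f Rn_upd[OF x(1) i] in blast)
  then have "deriv (\<lambda>t. f (x(i := t))) (x i) = deriv (\<lambda>t. 0) (x i)" by (rule deriv_cong_ev) simp
  then show ?thesis by (simp add: partial_def)
qed

text \<open>
  The support is closed and contained in the open ball, so \<open>q\<close> vanishes near every point outside the
  ball, including its boundary.
\<close>

lemma hess_zero_outside_support:
  assumes q: "smooth_compact_support_in n (ball_Rn n (ereal R)) q" and y: "y \<in> Rn n" "norm_Rn n y \<ge> R"
    and ij: "i < n" "j < n"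
  shows "partial i (partial j q) y = 0"
proof -
  let ?U = "- closure {x \<in> Rn n. q x \<noteq> 0}"
  have yU: "y \<in> ?U" using q y unfolding smooth_compact_support_in_def ball_Rn_def by auto
  have q0: "q x = 0" if "x \<in> Rn n" "x \<in> ?U" for x using that subsetD[OF closure_subset, of x "{x \<in> Rn n. q x \<noteq> 0}"] by auto
  have "open ?U" by (intro open_Compl closed_closure)
  note zero = partial_zero_on_open[OF this]
  have q1: "partial j q x = 0" if "x \<in> Rn n" "x \<in> ?U" for x
    by (rule zero[OF q0 ij(2) that])
  show ?thesis by (rule zero[OF q1 ij(1) y(1) yU])
qed

text \<open>
  Here \<open>X\<close> stands for a smooth lower bound, exact at \<open>t = 0\<close>, of a weight that is added to \<open>ln G\<close>.
  Replacing the weight by \<open>X\<close> keeps the maximum.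
\<close>

lemma maximum_with_touching_function:
  assumes G: "smooth_Rn n G" and pos: "\<And>x. x \<in> Rn n \<Longrightarrow> G x > 0" and x0: "x0 \<in> Rn n" "G x0 = 1"
    and X: "\<And>t. (X has_real_derivative X' t) (at t)" and X': "(X' has_real_derivative X2) (at 0)"
    and max: "\<forall>\<^sub>F t in nhds 0. ln (G (line n x0 w t)) + X t \<le> X 0"
  shows "dir_deriv n w G x0 = - X' 0" and "dir_deriv n w (dir_deriv n w G) x0 - (dir_deriv n w G x0)\<^sup>2 + X2 \<le> 0"
proof -
  let ?l = "line n x0 w"
  let ?k = "\<lambda>t. ln (G (?l t)) + X t"
  let ?k' = "\<lambda>t. dir_deriv n w G (?l t) / G (?l t) + X' t"
  have k1: "(?k has_real_derivative ?k' t) (at t)" for t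
    by (rule DERIV_cong[OF DERIV_add[OF DERIV_chain2[OF DERIV_ln_divide dir_deriv_line[OF G]] X]]) (simp_all add: pos)
  have k2: "(?k' has_real_derivative dir_deriv n w (dir_deriv n w G) x0 - (dir_deriv n w G x0)\<^sup>2 + X2) (at 0)"
  proof (rule DERIV_cong[OF DERIV_add[OF DERIV_divide[OF dir_deriv_line[OF smooth_dir_deriv[OF G]] dir_deriv_line[OF G]] X']])
    show "G (?l 0) \<noteq> 0" by (simp add: x0)
  qed (simp add: x0 power2_eq_square)
  have "\<forall>\<^sub>F t in nhds 0. ?k t \<le> ?k 0" using max by eventually_elim (simp add: x0)
  note m = local_max_second_derivative[OF k1 k2 this]
  show "dir_deriv n w G x0 = - X' 0" using m(1) by (simp add: x0)
  show "dir_deriv n w (dir_deriv n w G) x0 - (dir_deriv n w G x0)\<^sup>2 + X2 \<le> 0" by (rule m(2))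
qed

lemma grad_apply: "k < n \<Longrightarrow> grad n f x k = partial k f x"
  by (simp add: grad_def)

lemma grad_Rn: "grad n f x \<in> Rn n"
  by (simp add: grad_def)

lemma dir_deriv_grad: "dir_deriv n e f x = (\<Sum>k<n. e k * grad n f x k)"
  by (simp add: dir_deriv_def grad_apply)

lemma dir_deriv_dir_deriv_const: 
  assumes "smooth_Rn n \<phi>" "x \<in> Rn n"
  shows "dir_deriv n w (dir_deriv n p \<phi>) x = (\<Sum>k<n. p k * dir_deriv n w (partial k \<phi>) x)"
    and "dir_deriv n w (dir_deriv n w (dir_deriv n p \<phi>)) x = (\<Sum>k<n. p k * dir_deriv n w (dir_deriv n w (partial k \<phi>)) x)"
proof -
  have 1: "dir_deriv n w (dir_deriv n p \<phi>) x = (\<Sum>k<n. p k * dir_deriv n w (partial k \<phi>) x)" if "x \<in> Rn n" for x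
    unfolding dir_deriv_def[of n p, abs_def] using assms that by (intro dir_deriv_of_sum) (auto intro: smooth_partial)
  show "dir_deriv n w (dir_deriv n p \<phi>) x = (\<Sum>k<n. p k * dir_deriv n w (partial k \<phi>) x)" by (rule 1[OF assms(2)])
  have "dir_deriv n w (dir_deriv n w (dir_deriv n p \<phi>)) x = dir_deriv n w (\<lambda>x. \<Sum>k<n. p k * dir_deriv n w (partial k \<phi>) x) x"
    by (rule dir_deriv_cong[OF 1 assms(2)])
  also have "\<dots> = (\<Sum>k<n. p k * dir_deriv n w (dir_deriv n w (partial k \<phi>)) x)"
    using assms by (intro dir_deriv_of_sum) (auto intro: smooth_partial smooth_dir_deriv)
  finally show "dir_deriv n w (dir_deriv n w (dir_deriv n p \<phi>)) x = (\<Sum>k<n. p k * dir_deriv n w (dir_deriv n w (partial k \<phi>)) x)" .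
qed

text \<open>
  For \<open>|\<nabla>\<phi>(x0)| < R\<close> the weight is the quadratic \<open>lq |y|\<^sup>2 / 2\<close> in a neighbourhood, with gradient
  \<open>p\<close>.
\<close>

lemma maximum_quadratic_weight:
  assumes \<phi>: "smooth_Rn n \<phi>" and G: "smooth_Rn n G" and pos: "\<And>x. x \<in> Rn n \<Longrightarrow> G x > 0"
    and x0: "x0 \<in> Rn n" "G x0 = 1"
    and \<Psi>: "\<And>t. 0 \<le> t \<Longrightarrow> t \<le> R \<Longrightarrow> \<Psi> t = lq * t\<^sup>2 / 2"
    and max: "\<And>x. x \<in> Rn n \<Longrightarrow> ln (G x) + \<Psi> (norm_Rn n (grad n \<phi> x)) \<le> \<Psi> (norm_Rn n (grad n \<phi> x0))"
    and y0: "norm_Rn n (grad n \<phi> x0) < R"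
  defines "p \<equiv> \<lambda>k. lq * grad n \<phi> x0 k"
  shows "dir_deriv n w G x0 = - dir_deriv n w (dir_deriv n p \<phi>) x0"
    and "dir_deriv n w (dir_deriv n w G) x0 - (dir_deriv n w G x0)\<^sup>2
       + (lq * (\<Sum>k<n. (dir_deriv n w (partial k \<phi>) x0)\<^sup>2) + dir_deriv n w (dir_deriv n w (dir_deriv n p \<phi>)) x0) \<le> 0"
proof -
  let ?l = "line n x0 w"
  define X where "X t = lq / 2 * (\<Sum>k<n. (partial k \<phi> (?l t))\<^sup>2)" for t
  define X' where "X' t = lq * (\<Sum>k<n. partial k \<phi> (?l t) * dir_deriv n w (partial k \<phi>) (?l t))" for t
  define X2 where "X2 = lq * (\<Sum>k<n. (dir_deriv n w (partial k \<phi>) x0)\<^sup>2 + partial k \<phi> x0 * dir_deriv n w (dir_deriv n w (partial k \<phi>)) x0)"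
  have d: "((\<lambda>t. partial k \<phi> (?l t)) has_real_derivative dir_deriv n w (partial k \<phi>) (?l t)) (at t)" if "k < n" for k t
    by (rule dir_deriv_line[OF smooth_partial[OF \<phi> that]])
  have d': "((\<lambda>t. dir_deriv n w (partial k \<phi>) (?l t)) has_real_derivative dir_deriv n w (dir_deriv n w (partial k \<phi>)) (?l t)) (at t)" if "k < n" for k t
    by (rule dir_deriv_line[OF smooth_dir_deriv[OF smooth_partial[OF \<phi> that]]])
  have X1: "(X has_real_derivative X' t) (at t)" for t
  proof -
    have "((\<lambda>t. lq / 2 * (\<Sum>k<n. (partial k \<phi> (?l t))\<^sup>2)) has_real_derivative
        lq / 2 * (\<Sum>k<n. real 2 * (dir_deriv n w (partial k \<phi>) (?l t) * partial k \<phi> (?l t) ^ (2 - Suc 0)))) (at t)"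
      by (intro DERIV_cmult DERIV_sum DERIV_power d) auto
    then show ?thesis by (simp add: X_def[abs_def] X'_def sum_distrib_left mult_ac)
  qed
  have X'1: "(X' has_real_derivative X2) (at 0)"
  proof -
    have "((\<lambda>t. lq * (\<Sum>k<n. partial k \<phi> (?l t) * dir_deriv n w (partial k \<phi>) (?l t))) has_real_derivative
        lq * (\<Sum>k<n. dir_deriv n w (partial k \<phi>) (?l 0) * dir_deriv n w (partial k \<phi>) (?l 0)
          + dir_deriv n w (dir_deriv n w (partial k \<phi>)) (?l 0) * partial k \<phi> (?l 0))) (at 0)"
      by (intro DERIV_cmult DERIV_sum DERIV_mult d d') auto
    then show ?thesis by (simp add: X'_def[abs_def] X2_def x0 power2_eq_square mult_ac)
  qed
  have nrm: "(norm_Rn n (grad n \<phi> x))\<^sup>2 = (\<Sum>k<n. (partial k \<phi> x)\<^sup>2)" for x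
    by (simp add: norm_Rn_sq grad_apply)
  have "isCont (\<lambda>t. \<Sum>k<n. (partial k \<phi> (?l t))\<^sup>2) 0"
    by (intro continuous_intros DERIV_isCont[OF d]) auto
  then have "((\<lambda>t. \<Sum>k<n. (partial k \<phi> (?l t))\<^sup>2) \<longlongrightarrow> (norm_Rn n (grad n \<phi> x0))\<^sup>2) (nhds 0)"
    using tendsto_at_iff_tendsto_nhds[of "\<lambda>t. \<Sum>k<n. (partial k \<phi> (?l t))\<^sup>2" 0]
    by (simp add: nrm x0 isCont_def)
  then have "\<forall>\<^sub>F t in nhds 0. (\<Sum>k<n. (partial k \<phi> (?l t))\<^sup>2) < R\<^sup>2"
    by (rule order_tendstoD) (use y0 norm_Rn_nonneg in \<open>auto intro!: power_strict_mono\<close>)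
  then have ev: "\<forall>\<^sub>F t in nhds 0. ln (G (?l t)) + X t \<le> X 0"
  proof eventually_elim
    case (elim t)
    then have "(norm_Rn n (grad n \<phi> (?l t)))\<^sup>2 < R\<^sup>2" by (simp add: nrm)
    then have "norm_Rn n (grad n \<phi> (?l t)) < R"
      by (rule power2_less_imp_less) (use y0 norm_Rn_nonneg[of n "grad n \<phi> x0"] in linarith)
    then have "\<Psi> (norm_Rn n (grad n \<phi> (?l t))) = X t"
      by (simp add: \<Psi> norm_Rn_nonneg nrm X_def)
    moreover have "\<Psi> (norm_Rn n (grad n \<phi> x0)) = X 0"
      using y0 by (simp add: \<Psi> norm_Rn_nonneg nrm X_def x0)
    ultimately show ?case using max[of "?l t"] by simp
  qed
  note m = maximum_with_touching_function[OF G pos x0 X1 X'1 ev]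
  have "X' 0 = dir_deriv n w (dir_deriv n p \<phi>) x0"
    by (simp add: X'_def p_def x0 dir_deriv_dir_deriv_const[OF \<phi> x0(1)] grad_apply sum_distrib_left mult.assoc)
  with m(1) show "dir_deriv n w G x0 = - dir_deriv n w (dir_deriv n p \<phi>) x0" by simp
  have "X2 = lq * (\<Sum>k<n. (dir_deriv n w (partial k \<phi>) x0)\<^sup>2) + dir_deriv n w (dir_deriv n w (dir_deriv n p \<phi>)) x0"
    by (simp add: X2_def p_def x0 dir_deriv_dir_deriv_const[OF \<phi> x0(1)] grad_apply sum_distrib_left sum.distrib algebra_simps)
  with m(2) show "dir_deriv n w (dir_deriv n w G) x0 - (dir_deriv n w G x0)\<^sup>2
       + (lq * (\<Sum>k<n. (dir_deriv n w (partial k \<phi>) x0)\<^sup>2) + dir_deriv n w (dir_deriv n w (dir_deriv n p \<phi>)) x0) \<le> 0"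
    by simp
qed

text \<open>
  Since \<open>\<Psi>\<close> is nondecreasing, \<open>\<Psi>(|y|) \<ge> \<Psi>(\<langle>e, y\<rangle>)\<close> for the unit vector \<open>e\<close> along \<open>\<nabla>\<phi>(x0)\<close>, and the
  right-hand side lies above a parabola in the linear function \<open>\<langle>e, y\<rangle>\<close>. This parabola touches the weight at
  \<open>\<nabla>\<phi>(x0)\<close>; its second derivative is \<open>- l/2\<close> in direction \<open>e\<close> and zero across it.
\<close>

lemma maximum_semiconvex_weight:
  assumes \<phi>: "smooth_Rn n \<phi>" and G: "smooth_Rn n G" and pos: "\<And>x. x \<in> Rn n \<Longrightarrow> G x > 0"
    and x0: "x0 \<in> Rn n" "G x0 = 1"
    and \<Psi>: "\<And>t. 0 \<le> t \<Longrightarrow> \<Psi> r + \<delta> * (t - r) - l / 4 * (t - r)\<^sup>2 \<le> \<Psi> t"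
    and mono: "\<And>s t. 0 \<le> s \<Longrightarrow> s \<le> t \<Longrightarrow> \<Psi> s \<le> \<Psi> t" and \<delta>: "\<delta> \<ge> 0" and l: "l \<ge> 0"
    and max: "\<And>x. x \<in> Rn n \<Longrightarrow> ln (G x) + \<Psi> (norm_Rn n (grad n \<phi> x)) \<le> \<Psi> r"
    and r: "r = norm_Rn n (grad n \<phi> x0)" "r > 0"
  defines "e \<equiv> \<lambda>k. grad n \<phi> x0 k / r"
  defines "p \<equiv> \<lambda>k. \<delta> * e k"
  shows "dir_deriv n w G x0 = - dir_deriv n w (dir_deriv n p \<phi>) x0"
    and "dir_deriv n w (dir_deriv n w G) x0 - (dir_deriv n w G x0)\<^sup>2
       + (- l / 2 * (dir_deriv n w (dir_deriv n e \<phi>) x0)\<^sup>2 + dir_deriv n w (dir_deriv n w (dir_deriv n p \<phi>)) x0) \<le> 0"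
proof -
  let ?l = "line n x0 w"
  define E where "E t = dir_deriv n e \<phi> (?l t)" for t
  define E' where "E' t = dir_deriv n w (dir_deriv n e \<phi>) (?l t)" for t
  define E2 where "E2 = dir_deriv n w (dir_deriv n w (dir_deriv n e \<phi>)) x0"
  define X where "X t = \<Psi> r + \<delta> * (E t - r) - l / 4 * (E t - r)\<^sup>2" for t
  define X' where "X' t = \<delta> * E' t - l / 2 * ((E t - r) * E' t)" for t
  have r_sq: "(\<Sum>k<n. (grad n \<phi> x0 k)\<^sup>2) = r\<^sup>2" unfolding r(1) norm_Rn_sq ..
  have e1: "(\<Sum>k<n. (e k)\<^sup>2) = 1"
    using r(2) r_sq by (simp add: e_def power_divide sum_divide_distrib[symmetric])
  have "E 0 = (\<Sum>k<n. (grad n \<phi> x0 k)\<^sup>2) / r"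
    by (simp add: E_def x0 dir_deriv_grad e_def power2_eq_square sum_divide_distrib)
  then have E0: "E 0 = r" using r(2) r_sq by (simp add: power2_eq_square)
  have dE: "(E has_real_derivative E' t) (at t)" for t
    unfolding E_def[abs_def] E'_def by (rule dir_deriv_line[OF smooth_dir_deriv[OF \<phi>]])
  have dE': "(E' has_real_derivative E2) (at 0)"
    using dir_deriv_line[OF smooth_dir_deriv[OF smooth_dir_deriv[OF \<phi>]], of w e x0 w 0]
    by (simp add: E'_def[abs_def] E2_def x0)
  have X1: "(X has_real_derivative X' t) (at t)" for t
    unfolding X_def[abs_def] X'_def by (auto intro!: derivative_eq_intros dE simp: field_simps)
  have X'1: "(X' has_real_derivative \<delta> * E2 - l / 2 * (E' 0)\<^sup>2) (at 0)"
    unfolding X'_def[abs_def] by (auto intro!: derivative_eq_intros dE dE' simp: E0 power2_eq_square)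
  have ev: "ln (G (?l t)) + X t \<le> X 0" for t
  proof -
    let ?N = "norm_Rn n (grad n \<phi> (?l t))"
    have "(E t)\<^sup>2 \<le> (\<Sum>k<n. (e k)\<^sup>2) * (\<Sum>k<n. (grad n \<phi> (?l t) k)\<^sup>2)"
      unfolding E_def dir_deriv_grad by (rule Cauchy_Schwarz_ineq_sum)
    then have "(E t)\<^sup>2 \<le> ?N\<^sup>2" by (simp add: e1 norm_Rn_sq)
    then have EN: "E t \<le> ?N" by (rule power2_le_imp_le) (rule norm_Rn_nonneg)
    have "X t \<le> \<Psi> ?N"
    proof (cases "E t \<ge> 0")
      case True
      show ?thesis using \<Psi>[OF True] mono[OF True EN] by (simp add: X_def)
    next
      case False
      \<comment> \<open>The parabola increases up to its point of contact r, so its value here is below the one at 0.\<close>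
      then have "\<delta> * E t \<le> 0" using \<delta> by (simp add: mult_nonneg_nonpos)
      moreover have "r\<^sup>2 \<le> (r - E t)\<^sup>2" using False r(2) by (intro power_mono) auto
      then have "l / 4 * (0 - r)\<^sup>2 \<le> l / 4 * (E t - r)\<^sup>2"
        using l by (intro mult_left_mono) (auto simp: power2_commute)
      ultimately have "X t \<le> \<Psi> r + \<delta> * (0 - r) - l / 4 * (0 - r)\<^sup>2"
        by (simp add: X_def algebra_simps)
      also have "\<dots> \<le> \<Psi> 0" by (rule \<Psi>) simp
      also have "\<dots> \<le> \<Psi> ?N" by (rule mono) (auto simp: norm_Rn_nonneg)
      finally show ?thesis .
    qed
    moreover have "X 0 = \<Psi> r" by (simp add: X_def E0)
    ultimately show ?thesis using max[of "?l t"] by simp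
  qed
  note m = maximum_with_touching_function[OF G pos x0 X1 X'1 always_eventually[OF allI[OF ev]]]
  have p: "dir_deriv n p f = (\<lambda>x. \<delta> * dir_deriv n e f x)" for f
    unfolding p_def by (simp add: fun_eq_iff dir_deriv_scale)
  have p1: "dir_deriv n w (dir_deriv n p \<phi>) x0 = \<delta> * dir_deriv n w (dir_deriv n e \<phi>) x0"
    by (simp add: dir_deriv_dir_deriv_const[OF \<phi> x0(1)] p_def sum_distrib_left mult.assoc)
  have p2: "dir_deriv n w (dir_deriv n w (dir_deriv n p \<phi>)) x0 = \<delta> * dir_deriv n w (dir_deriv n w (dir_deriv n e \<phi>)) x0"
    by (simp add: dir_deriv_dir_deriv_const[OF \<phi> x0(1)] p_def sum_distrib_left mult.assoc)
  show "dir_deriv n w G x0 = - dir_deriv n w (dir_deriv n p \<phi>) x0"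
    using m(1) by (simp add: X'_def E0 p1 E'_def x0)
  show "dir_deriv n w (dir_deriv n w G) x0 - (dir_deriv n w G x0)\<^sup>2
       + (- l / 2 * (dir_deriv n w (dir_deriv n e \<phi>) x0)\<^sup>2 + dir_deriv n w (dir_deriv n w (dir_deriv n p \<phi>)) x0) \<le> 0"
    using m(2) by (simp add: p2 E'_def E2_def x0)
qed

text \<open>
  Add up the second-order conditions over the frame. The fourth derivatives of \<open>\<phi>\<close> are eliminated by the
  second variation of the equation along \<open>u\<close>; the squared third derivatives that it provides dominate
  those from the logarithm in \<open>ln \<phi>\<^sub>u\<^sub>u\<close>. The terms \<open>D\<^sup>2\<phi>(v\<^sub>i, v\<^sub>i)\<close> differentiated along \<open>p\<close> are eliminated
  by the first variation of the equation. The two terms with \<open>\<nabla>W\<close> then cancel by the first-order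
  condition.
\<close>

lemma maximum_inequality:
  assumes \<phi>: "smooth_Rn n \<phi>" and V: "smooth_Rn n V" and W: "smooth_Rn n W"
    and n: "0 < n" and x0: "x0 \<in> Rn n"
    and det: "\<And>x. x \<in> Rn n \<Longrightarrow> Determinant.det (hessian n \<phi> x) > 0"
    and MA: "\<And>x. x \<in> Rn n \<Longrightarrow> ln (Determinant.det (hessian n \<phi> x)) = - V x + W (grad n \<phi> x) - c"
    and pd: "\<And>x. x \<in> Rn n \<Longrightarrow> pos_def n (hess \<phi> x)"
    and v: "\<And>i j. i < n \<Longrightarrow> j < n \<Longrightarrow> bilin n (hess \<phi> x0) (v i) (v j) = (if i = j then 1 else 0)"
  defines "u \<equiv> v 0"
  defines "G \<equiv> dir_deriv n u (dir_deriv n u \<phi>)"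
  assumes first: "\<And>w. dir_deriv n w G x0 = - dir_deriv n w (dir_deriv n p \<phi>) x0"
    and second: "\<And>w. dir_deriv n w (dir_deriv n w G) x0 - (dir_deriv n w G x0)\<^sup>2
        + (Q w + dir_deriv n w (dir_deriv n w (dir_deriv n p \<phi>)) x0) \<le> 0"
  defines "z \<equiv> \<lambda>k. dir_deriv n u (partial k \<phi>) x0"
  shows "- dir_deriv n u (dir_deriv n u V) x0 + dir_deriv n z (dir_deriv n z W) (grad n \<phi> x0) + (\<Sum>i<n. Q (v i)) \<le> dir_deriv n p V x0"
proof -
  let ?y = "grad n \<phi> x0"
  have smk: "smooth_Rn n (partial k \<phi>)" if "k < n" for k using smooth_partial[OF \<phi> that] .
  define F' where "F' w t = - dir_deriv n w V (line n x0 w t)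
      + (\<Sum>k<n. dir_deriv n w (partial k \<phi>) (line n x0 w t) * partial k W (grad n \<phi> (line n x0 w t)))" for w t
  define F2 where "F2 w = - dir_deriv n w (dir_deriv n w V) x0
      + ((\<Sum>k<n. dir_deriv n w (dir_deriv n w (partial k \<phi>)) x0 * partial k W ?y)
      + (\<Sum>k<n. \<Sum>l<n. dir_deriv n w (partial k \<phi>) x0 * dir_deriv n w (partial l \<phi>) x0 * partial l (partial k W) ?y))" for w
  have F1: "((\<lambda>t. ln (Determinant.det (hessian n \<phi> (line n x0 w t)))) has_real_derivative F' w t) (at t)" for w t
    unfolding MA[OF line_Rn] F'_def unfolding grad_def
    by (rule DERIV_cong[OF DERIV_diff[OF DERIV_add[OF DERIV_minus[OF dir_deriv_line[OF V]]
          composition_derivatives(1)[OF W smk]] DERIV_const]]) simp_all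
  have dF': "(F' w has_real_derivative F2 w) (at 0)" for w
    unfolding F'_def[abs_def] F2_def unfolding grad_def
    by (rule DERIV_cong[OF DERIV_add[OF DERIV_minus[OF dir_deriv_line[OF smooth_dir_deriv[OF V]]]
          composition_derivatives(2)[OF W smk]]]) (simp_all add: x0)
  define T where "T i = dir_deriv n (v i) G x0" for i
  have F'p: "F' p 0 = (\<Sum>i<n. dir_deriv n p (dir_deriv n (v i) (dir_deriv n (v i) \<phi>)) x0)"
    by (rule log_det_comparison(1)[OF \<phi> n x0 det pd v _ F1 dF', where s = "\<lambda>_. 0"]) simp_all
  have F2u: "F2 u \<le> (\<Sum>i<n. dir_deriv n (v i) (dir_deriv n (v i) G) x0 - (T i)\<^sup>2)"
  proof -
    \<comment> \<open>The shear T i minimises the quadratic polynomial in s i; the index 0 gets its square from the logarithm instead.\<close>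
    define s where "s = T(0 := 0)"
    have "F2 u \<le> (\<Sum>i<n. dir_deriv n u (dir_deriv n u (dir_deriv n (v i) (dir_deriv n (v i) \<phi>))) x0
                 - 4 * s i * dir_deriv n u (dir_deriv n (v i) (dir_deriv n (v 0) \<phi>)) x0 + 2 * (s i)\<^sup>2
                 - (dir_deriv n u (dir_deriv n (v i) (dir_deriv n (v i) \<phi>)) x0)\<^sup>2)"
      by (rule log_det_comparison(2)[OF \<phi> n x0 det pd v _ F1 dF']) (simp_all add: s_def)
    also have "\<dots> \<le> (\<Sum>i<n. dir_deriv n (v i) (dir_deriv n (v i) G) x0 - (T i)\<^sup>2)"
    proof (rule sum_mono)
      fix i
      have 1: "dir_deriv n u (dir_deriv n u (dir_deriv n (v i) (dir_deriv n (v i) \<phi>))) x0 = dir_deriv n (v i) (dir_deriv n (v i) G) x0"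
        unfolding G_def by (rule dir_deriv_commute_2_2[OF \<phi> x0])
      have 2: "dir_deriv n u (dir_deriv n (v i) (dir_deriv n (v 0) \<phi>)) x0 = T i"
        unfolding T_def G_def u_def by (rule dir_deriv_commute[OF smooth_dir_deriv[OF \<phi>] x0])
      show "dir_deriv n u (dir_deriv n u (dir_deriv n (v i) (dir_deriv n (v i) \<phi>))) x0
                 - 4 * s i * dir_deriv n u (dir_deriv n (v i) (dir_deriv n (v 0) \<phi>)) x0 + 2 * (s i)\<^sup>2
                 - (dir_deriv n u (dir_deriv n (v i) (dir_deriv n (v i) \<phi>)) x0)\<^sup>2
              \<le> dir_deriv n (v i) (dir_deriv n (v i) G) x0 - (T i)\<^sup>2"
      proof (cases "i = 0")
        case True
        then show ?thesis unfolding 1 2 by (simp add: s_def T_def G_def u_def)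
      next
        case False
        then have "s i = T i" by (simp add: s_def)
        then show ?thesis unfolding 1 2 by (simp add: power2_eq_square algebra_simps)
      qed
    qed
    finally show ?thesis .
  qed
  have "(\<Sum>i<n. dir_deriv n (v i) (dir_deriv n (v i) G) x0 - (T i)\<^sup>2
      + (Q (v i) + dir_deriv n p (dir_deriv n (v i) (dir_deriv n (v i) \<phi>)) x0)) \<le> 0"
  proof (rule sum_nonpos)
    fix i
    show "dir_deriv n (v i) (dir_deriv n (v i) G) x0 - (T i)\<^sup>2 + (Q (v i) + dir_deriv n p (dir_deriv n (v i) (dir_deriv n (v i) \<phi>)) x0) \<le> 0"
      using second[of "v i"] by (simp add: T_def dir_deriv_commute_1_2[OF \<phi> x0])
  qed
  then have main: "F2 u + (\<Sum>i<n. Q (v i)) + F' p 0 \<le> 0"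
    using F2u unfolding F'p by (simp add: sum.distrib)
  have "dir_deriv n u (dir_deriv n u (partial k \<phi>)) x0 = - dir_deriv n p (partial k \<phi>) x0" if k: "k < n" for k
  proof -
    obtain e where e: "\<And>f. partial k f = dir_deriv n e f" using partial_dir_deriv[OF k] by blast
    have "dir_deriv n u (dir_deriv n u (partial k \<phi>)) x0 = dir_deriv n e G x0"
      unfolding e G_def by (rule dir_deriv_commute_1_2[OF \<phi> x0])
    also have "\<dots> = - dir_deriv n e (dir_deriv n p \<phi>) x0" by (rule first)
    also have "dir_deriv n e (dir_deriv n p \<phi>) x0 = dir_deriv n p (partial k \<phi>) x0"
      unfolding e by (rule dir_deriv_commute[OF \<phi> x0])
    finally show ?thesis .
  qed
  then have "(\<Sum>k<n. dir_deriv n u (dir_deriv n u (partial k \<phi>)) x0 * partial k W ?y)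
      = - (\<Sum>k<n. dir_deriv n p (partial k \<phi>) x0 * partial k W ?y)"
    by (simp add: sum_negf)
  moreover have "(\<Sum>k<n. \<Sum>l<n. dir_deriv n u (partial k \<phi>) x0 * dir_deriv n u (partial l \<phi>) x0 * partial l (partial k W) ?y)
      = dir_deriv n z (dir_deriv n z W) ?y"
    unfolding dir_deriv_dir_deriv[OF W grad_Rn] z_def by (subst sum.swap) (simp add: mult.commute)
  ultimately show ?thesis using main by (simp add: F2_def F'_def x0)
qed

section \<open>The bound\<close>

text \<open>
  The bound for \<open>\<langle>\<nabla>V(x), \<nabla>\<psi>(y)\<rangle>\<close> over \<open>|x| \<le> P'\<close> that \<open>gradient_upper_bound\<close> gives with
  \<open>|\<nabla>\<psi>| \<le> lq P\<close>. The last factor of \<open>pogorelov_bound\<close> bounds \<open>exp \<psi>\<close>.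
\<close>

definition drift_bound :: "real \<Rightarrow> real \<Rightarrow> real \<Rightarrow> real \<Rightarrow> real \<Rightarrow> real" where
  "drift_bound R P' l L lq = L / 2 * (P'\<^sup>2 + (lq * const_P R l lq)\<^sup>2)"

definition pogorelov_bound :: "real \<Rightarrow> real \<Rightarrow> real \<Rightarrow> real \<Rightarrow> real \<Rightarrow> real" where
  "pogorelov_bound R P' l L lq =
     (1 + 2 * (L + drift_bound R P' l L lq) / l) * exp (lq * (const_P R l lq)\<^sup>2)"

lemma quadratic_inequality_bound:
  fixes M l L K :: real
  assumes "l > 0" "L > 0" "K \<ge> 0" "M > 0" and le: "l / 2 * M \<le> L / M + K"
  shows "M \<le> 1 + 2 * (L + K) / l"
proof (cases "M \<ge> 1")
  case True
  then have "L / M \<le> L" using assms by (simp add: field_simps)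
  with le have "l / 2 * M \<le> L + K" by linarith
  then have "l * M \<le> 2 * (L + K)" by simp
  then have "M \<le> 2 * (L + K) / l" using assms by (simp add: field_simps)
  then show ?thesis by simp
next
  case False
  then have "M \<le> 1" by simp
  also have "\<dots> \<le> 1 + 2 * (L + K) / l" using assms by simp
  finally show ?thesis .
qed

lemma R_less_const_P:
  assumes "R > 0" "l > 0" "lq \<ge> 0"
  shows "R < const_P R l lq"
proof -
  have "(2 * lq + 4 * lq * R) / l \<ge> 0" using assms by simp
  then show ?thesis by (simp add: const_P_def)
qed

text \<open>
  The case distinction is that of the two touching functions: inside \<open>B\<^sub>R\<close> the weight pays for the
  concavity of \<open>q\<close>, outside the uniform convexity of \<open>V\<close> pays for the weight.
\<close>

lemma hessian_bound_at_maximum: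
  assumes R: "R > 0" and l: "l > 0" and L: "L > 0" and lq: "lq \<ge> 0" and wd: "theta_well_defined R l lq"
    and V: "smooth_Rn n V" and Vmin: "\<And>x. x \<in> Rn n \<Longrightarrow> V (origin_Rn n) \<le> V x"
    and Vge: "hessian_ge n l V" and Vle: "hessian_le n L V"
    and q: "smooth_compact_support_in n (ball_Rn n (ereal R)) q" and qge: "hessian_ge n (- lq) q"
    and \<phi>: "smooth_Rn n \<phi>" and cv: "convex_fun_Rn n \<phi>"
    and MA: "\<And>x. x \<in> Rn n \<Longrightarrow> Determinant.det (hessian n \<phi> x) =
        exp (- V x + (V (grad n \<phi> x) + q (grad n \<phi> x)) - c)"
    and loc: "\<And>x. x \<in> Rn n \<Longrightarrow> norm_Rn n (grad n \<phi> x) < const_P R l lq \<Longrightarrow> norm_Rn n x \<le> P'"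
    and x0: "x0 \<in> Rn n" and \<alpha>0: "\<alpha>0 \<in> sphere_Rn n"
    and max: "\<And>x \<alpha>. x \<in> Rn n \<Longrightarrow> \<alpha> \<in> sphere_Rn n \<Longrightarrow> h_fun R l lq n \<phi> x \<alpha> \<le> h_fun R l lq n \<phi> x0 \<alpha>0"
    and n: "0 < n"
  shows "h_fun R l lq n \<phi> x0 \<alpha>0 \<le> pogorelov_bound R P' l L lq"
proof -
  let ?P = "const_P R l lq" and ?K = "drift_bound R P' l L lq"
  define W where "W = (\<lambda>y. V y + q y)"
  define y0 where "y0 = grad n \<phi> x0"
  define r where "r = norm_Rn n y0"
  define M where "M = dir_deriv n \<alpha>0 (dir_deriv n \<alpha>0 \<phi>) x0"
  define \<Psi> where "\<Psi> = psi_bar R l lq"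
  define d where "d = psi_bar_deriv R l lq"
  note d = psi_bar_properties[OF R l lq wd, folded \<Psi>_def d_def]
  have RP: "R < ?P" by (rule R_less_const_P[OF R l lq])
  have qs: "smooth_Rn n q" using q by (simp add: smooth_compact_support_in_def)
  have W: "smooth_Rn n W" unfolding W_def by (rule smooth_add[OF V qs])
  have y0: "y0 \<in> Rn n" unfolding y0_def by (rule grad_Rn)
  have r0: "r \<ge> 0" by (simp add: r_def norm_Rn_nonneg)
  have det: "Determinant.det (hessian n \<phi> x) > 0" if "x \<in> Rn n" for x using MA[OF that] by simp
  have lnMA: "ln (Determinant.det (hessian n \<phi> x)) = - V x + W (grad n \<phi> x) - c" if "x \<in> Rn n" for x
    using MA[OF that] by (simp add: W_def)
  have pd: "pos_def n (hess \<phi> x)" if "x \<in> Rn n" for x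
    by (rule convex_imp_pos_def[OF \<phi> cv that]) (use det[OF that] in simp)
  have pos: "dir_deriv n w (dir_deriv n w \<phi>) x > 0" if x: "x \<in> Rn n" and w: "(\<Sum>i<n. (w i)\<^sup>2) = 1" for w x
  proof -
    have "\<exists>i<n. w i \<noteq> 0" using w by (metis (no_types, lifting) lessThan_iff power_zero_numeral sum.neutral zero_neq_one)
    then show ?thesis using pd[OF x] unfolding bilin_hess[OF \<phi> x, symmetric] by (auto simp: pos_def_def)
  qed
  have unit: "(\<Sum>i<n. (\<alpha>0 i)\<^sup>2) = 1" using \<alpha>0 norm_Rn_sq[of n \<alpha>0] by (simp add: sphere_Rn_def)
  have M: "M > 0" unfolding M_def by (rule pos[OF x0 unit])
  have h: "h_fun R l lq n \<phi> x \<beta> = dir_deriv n \<beta> (dir_deriv n \<beta> \<phi>) x * exp (\<Psi> (norm_Rn n (grad n \<phi> x)))" if "x \<in> Rn n" for x \<beta>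
    by (simp add: h_fun_def hessian_form_dir_deriv[OF \<phi> that] psi_def \<Psi>_def)
  have h0: "h_fun R l lq n \<phi> x0 \<alpha>0 = M * exp (\<Psi> r)" by (simp add: h[OF x0] M_def r_def y0_def)
  \<comment> \<open>The weight does not depend on the direction, so a maximising direction maximises the Hessian form.\<close>
  have top: "dir_deriv n e (dir_deriv n e \<phi>) x0 \<le> M" if e: "(\<Sum>i<n. (e i)\<^sup>2) = 1" for e
  proof -
    have "(norm_Rn n (\<lambda>i\<in>{..<n}. e i))\<^sup>2 = 1\<^sup>2" using e by (simp add: norm_Rn_restrict norm_Rn_sq)
    then have "norm_Rn n (\<lambda>i\<in>{..<n}. e i) = 1"
      using norm_Rn_nonneg[of n "\<lambda>i\<in>{..<n}. e i"] by (simp only: power2_eq_iff) auto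
    then have "h_fun R l lq n \<phi> x0 (\<lambda>i\<in>{..<n}. e i) \<le> h_fun R l lq n \<phi> x0 \<alpha>0"
      by (intro max x0) (simp add: sphere_Rn_def)
    then show ?thesis unfolding h0 unfolding h[OF x0] by (simp add: dir_deriv_restrict r_def y0_def)
  qed
  define m where "m = sqrt M"
  have m: "m > 0" "m * m = M" using M by (auto simp: m_def)
  define u where "u = (\<lambda>i. (1 / m) * \<alpha>0 i)"
  define G where "G = dir_deriv n u (dir_deriv n u \<phi>)"
  have uu: "dir_deriv n u (dir_deriv n u \<phi>) x = dir_deriv n \<alpha>0 (dir_deriv n \<alpha>0 \<phi>) x / M" if "x \<in> Rn n" for x
  proof -
    have "dir_deriv n u (dir_deriv n u \<phi>) x = (\<Sum>i<n. \<Sum>j<n. (\<alpha>0 i * \<alpha>0 j * partial i (partial j \<phi>) x) / M)"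
      unfolding dir_deriv_dir_deriv[OF \<phi> that] u_def m(2)[symmetric] by simp
    then show ?thesis unfolding dir_deriv_dir_deriv[OF \<phi> that] by (simp add: sum_divide_distrib)
  qed
  have G: "smooth_Rn n G" unfolding G_def by (intro smooth_dir_deriv \<phi>)
  have Gpos: "G x > 0" if "x \<in> Rn n" for x
    unfolding G_def uu[OF that] using pos[OF that unit] M by simp
  have G0: "G x0 = 1" unfolding G_def uu[OF x0] using M by (simp add: M_def)
  have lnmax: "ln (G x) + \<Psi> (norm_Rn n (grad n \<phi> x)) \<le> \<Psi> r" if x: "x \<in> Rn n" for x
  proof -
    have "dir_deriv n \<alpha>0 (dir_deriv n \<alpha>0 \<phi>) x * exp (\<Psi> (norm_Rn n (grad n \<phi> x))) \<le> M * exp (\<Psi> r)"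
      using max[OF x \<alpha>0] unfolding h0 h[OF x] .
    then have "G x * exp (\<Psi> (norm_Rn n (grad n \<phi> x))) \<le> exp (\<Psi> r)"
      unfolding G_def uu[OF x] using M by (simp add: field_simps)
    then have "ln (G x * exp (\<Psi> (norm_Rn n (grad n \<phi> x)))) \<le> ln (exp (\<Psi> r))"
      using Gpos[OF x] by (intro ln_mono) auto
    then show ?thesis using Gpos[OF x] by (simp add: ln_mult_pos)
  qed
  have "bilin n (hess \<phi> x0) u u = 1" using G0 by (simp add: bilin_hess[OF \<phi> x0] G_def)
  from orthonormal_frame[OF pd[OF x0] this n] obtain v where v0: "v 0 = u"
    and v: "\<And>i j. i < n \<Longrightarrow> j < n \<Longrightarrow> bilin n (hess \<phi> x0) (v i) (v j) = (if i = j then 1 else 0)" by blast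
  define z where "z = (\<lambda>k. dir_deriv n u (partial k \<phi>) x0)"
  have ineq: "- dir_deriv n u (dir_deriv n u V) x0 + dir_deriv n z (dir_deriv n z W) y0 + (\<Sum>i<n. Q (v i)) \<le> dir_deriv n p V x0"
    if "\<And>w. dir_deriv n w G x0 = - dir_deriv n w (dir_deriv n p \<phi>) x0"
      and "\<And>w. dir_deriv n w (dir_deriv n w G) x0 - (dir_deriv n w G x0)\<^sup>2 + (Q w + dir_deriv n w (dir_deriv n w (dir_deriv n p \<phi>)) x0) \<le> 0"
    for Q p
    using maximum_inequality[OF \<phi> V W n x0 det lnMA pd v, of p Q] that
    unfolding v0 G_def z_def y0_def by blast
  have z2: "M \<le> (\<Sum>k<n. (z k)\<^sup>2)"
  proof -
    have "(\<Sum>k<n. \<alpha>0 k * z k) = dir_deriv n u (dir_deriv n \<alpha>0 \<phi>) x0"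
      by (simp add: z_def dir_deriv_dir_deriv_const[OF \<phi> x0])
    also have "\<dots> = M / m" unfolding u_def dir_deriv_scale by (simp add: M_def)
    also have "\<dots> = m" using m by (simp add: m(2)[symmetric])
    finally have "m\<^sup>2 \<le> (\<Sum>k<n. (\<alpha>0 k)\<^sup>2) * (\<Sum>k<n. (z k)\<^sup>2)"
      using Cauchy_Schwarz_ineq_sum[of \<alpha>0 z "{..<n}"] by simp
    then show ?thesis unfolding unit using m(2) by (simp add: power2_eq_square)
  qed
  have Vuu: "dir_deriv n u (dir_deriv n u V) x0 \<le> L / M"
  proof -
    have "(\<Sum>i<n. (u i)\<^sup>2) = 1 / M"
      using unit m by (simp add: u_def power_divide sum_divide_distrib[symmetric] power2_eq_square)
    then show ?thesis using hessian_leD[OF Vle V x0, of u] by simp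
  qed
  have Wzz: "dir_deriv n z (dir_deriv n z W) y0 = dir_deriv n z (dir_deriv n z V) y0 + dir_deriv n z (dir_deriv n z q) y0"
  proof -
    have add: "dir_deriv n z (\<lambda>x. f x + g x) x = dir_deriv n z f x + dir_deriv n z g x"
      if "smooth_Rn n f" "smooth_Rn n g" "x \<in> Rn n" for f g x
      unfolding dir_deriv_def sum.distrib[symmetric]
      by (intro sum.cong refl) (simp add: partial_add[OF that(1,2) _ that(3)] distrib_left)
    have "dir_deriv n z (dir_deriv n z W) y0 = dir_deriv n z (\<lambda>x. dir_deriv n z V x + dir_deriv n z q x) y0"
      unfolding W_def by (rule dir_deriv_cong[OF add[OF V qs] y0])
    also have "\<dots> = dir_deriv n z (dir_deriv n z V) y0 + dir_deriv n z (dir_deriv n z q) y0"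
      by (rule add[OF smooth_dir_deriv[OF V] smooth_dir_deriv[OF qs] y0])
    finally show ?thesis .
  qed
  have Vzz: "l * (\<Sum>k<n. (z k)\<^sup>2) \<le> dir_deriv n z (dir_deriv n z V) y0" by (rule hessian_geD[OF Vge V y0])
  have zz: "(\<Sum>k<n. (z k)\<^sup>2) \<ge> 0" by (simp add: sum_nonneg)
  have K0: "?K \<ge> 0" using L by (simp add: drift_bound_def)
  have drift: "dir_deriv n p V x0 \<le> ?K" if p: "(\<Sum>i<n. (p i)\<^sup>2) \<le> (lq * ?P)\<^sup>2" and "r < ?P" for p
  proof -
    have "norm_Rn n x0 \<le> P'" using loc[OF x0] that(2) by (simp add: r_def y0_def)
    then have "(norm_Rn n x0)\<^sup>2 \<le> P'\<^sup>2" using norm_Rn_nonneg by (intro power_mono) auto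
    then have "L / 2 * ((\<Sum>i<n. (x0 i)\<^sup>2) + (\<Sum>i<n. (p i)\<^sup>2)) \<le> ?K"
      unfolding drift_bound_def using L p by (intro mult_left_mono add_mono) (simp_all add: norm_Rn_sq)
    then show ?thesis using gradient_upper_bound[OF V Vmin Vge _ Vle x0, of p] l by simp
  qed
  have y0_sq: "(\<Sum>i<n. (y0 i)\<^sup>2) = r\<^sup>2" by (simp add: r_def norm_Rn_sq)
  have "l / 2 * M \<le> L / M + ?K"
  proof (cases "r < R")
    case True
    define p where "p = (\<lambda>k. lq * y0 k)"
    define Q where "Q w = lq * (\<Sum>k<n. (dir_deriv n w (partial k \<phi>) x0)\<^sup>2)" for w
    have main: "- dir_deriv n u (dir_deriv n u V) x0 + dir_deriv n z (dir_deriv n z W) y0 + (\<Sum>i<n. Q (v i)) \<le> dir_deriv n p V x0"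
    proof (rule ineq)
      fix w
      show "dir_deriv n w G x0 = - dir_deriv n w (dir_deriv n p \<phi>) x0"
        unfolding p_def y0_def
        by (rule maximum_quadratic_weight(1)[OF \<phi> G _ x0 G0, where \<Psi> = \<Psi> and R = R])
          (use d(6) lnmax True Gpos in \<open>simp_all add: r_def y0_def\<close>)
      show "dir_deriv n w (dir_deriv n w G) x0 - (dir_deriv n w G x0)\<^sup>2 + (Q w + dir_deriv n w (dir_deriv n w (dir_deriv n p \<phi>)) x0) \<le> 0"
        unfolding p_def y0_def Q_def
        by (rule maximum_quadratic_weight(2)[OF \<phi> G _ x0 G0, where \<Psi> = \<Psi> and R = R])
          (use d(6) lnmax True Gpos in \<open>simp_all add: r_def y0_def\<close>)
    qed
    have "lq * (\<Sum>k<n. (z k)\<^sup>2) = Q (v 0)" by (simp add: Q_def v0 z_def)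
    also have "\<dots> \<le> (\<Sum>i<n. Q (v i))"
      by (rule member_le_sum) (use n lq in \<open>auto simp: Q_def sum_nonneg\<close>)
    finally have "lq * (\<Sum>k<n. (z k)\<^sup>2) \<le> (\<Sum>i<n. Q (v i))" .
    moreover have "- lq * (\<Sum>k<n. (z k)\<^sup>2) \<le> dir_deriv n z (dir_deriv n z q) y0" by (rule hessian_geD[OF qge qs y0])
    moreover have "l / 2 * M \<le> l * (\<Sum>k<n. (z k)\<^sup>2)"
      using z2 l M by (intro mult_mono) auto
    moreover have "dir_deriv n p V x0 \<le> ?K"
    proof (rule drift)
      have "(\<Sum>i<n. (p i)\<^sup>2) = (lq * r)\<^sup>2"
        by (simp add: p_def power_mult_distrib sum_distrib_left[symmetric] y0_sq)
      also have "\<dots> \<le> (lq * ?P)\<^sup>2" using True RP r0 lq by (intro power_mono mult_left_mono) auto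
      finally show "(\<Sum>i<n. (p i)\<^sup>2) \<le> (lq * ?P)\<^sup>2" .
      show "r < ?P" using True RP by simp
    qed
    ultimately show ?thesis using main Vzz Vuu unfolding Wzz by linarith
  next
    case False
    then have rR: "r \<ge> R" and rpos: "r > 0" using R by auto
    define e where "e = (\<lambda>k. y0 k / r)"
    define p where "p = (\<lambda>k. d r * e k)"
    define Q where "Q w = - l / 2 * (dir_deriv n w (dir_deriv n e \<phi>) x0)\<^sup>2" for w
    have rdef: "r = norm_Rn n (grad n \<phi> x0)" by (simp add: r_def y0_def)
    have main: "- dir_deriv n u (dir_deriv n u V) x0 + dir_deriv n z (dir_deriv n z W) y0 + (\<Sum>i<n. Q (v i)) \<le> dir_deriv n p V x0"
    proof (rule ineq)
      fix w
      show "dir_deriv n w G x0 = - dir_deriv n w (dir_deriv n p \<phi>) x0"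
        unfolding p_def e_def y0_def
        by (rule maximum_semiconvex_weight(1)[OF \<phi> G _ x0 G0 _ _ _ _ _ rdef rpos, where \<Psi> = \<Psi> and l = l])
          (use d(4)[OF r0] d(5) d(1)[OF r0] l lnmax Gpos in simp_all)
      show "dir_deriv n w (dir_deriv n w G) x0 - (dir_deriv n w G x0)\<^sup>2 + (Q w + dir_deriv n w (dir_deriv n w (dir_deriv n p \<phi>)) x0) \<le> 0"
        unfolding p_def e_def y0_def Q_def
        by (rule maximum_semiconvex_weight(2)[OF \<phi> G _ x0 G0 _ _ _ _ _ rdef rpos, where \<Psi> = \<Psi> and l = l])
          (use d(4)[OF r0] d(5) d(1)[OF r0] l lnmax Gpos in simp_all)
    qed
    have e1: "(\<Sum>i<n. (e i)\<^sup>2) = 1"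
      using rpos by (simp add: e_def power_divide sum_divide_distrib[symmetric] y0_sq)
    have "(\<Sum>i<n. (dir_deriv n (v i) (dir_deriv n e \<phi>) x0)\<^sup>2) \<le> dir_deriv n e (dir_deriv n e \<phi>) x0"
      using Bessel[OF pd[OF x0] v, of e] by (simp add: bilin_hess[OF \<phi> x0])
    also have "\<dots> \<le> M" by (rule top[OF e1])
    finally have "l / 2 * (\<Sum>i<n. (dir_deriv n (v i) (dir_deriv n e \<phi>) x0)\<^sup>2) \<le> l / 2 * M"
      using l by (intro mult_left_mono) auto
    then have Qsum: "(\<Sum>i<n. Q (v i)) \<ge> - (l / 2 * M)"
      unfolding Q_def sum_distrib_left[symmetric] by simp
    have qzz: "dir_deriv n z (dir_deriv n z q) y0 = 0"
      unfolding dir_deriv_dir_deriv[OF qs y0]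
      using hess_zero_outside_support[OF q y0] rR by (simp add: r_def)
    have lM: "l * M \<le> l * (\<Sum>k<n. (z k)\<^sup>2)" using z2 l by simp
    have "dir_deriv n p V x0 \<le> ?K"
    proof (cases "r < ?P")
      case True
      have "(\<Sum>i<n. (p i)\<^sup>2) = (d r)\<^sup>2"
        by (simp add: p_def power_mult_distrib sum_distrib_left[symmetric] e1)
      also have "\<dots> \<le> (lq * ?P)\<^sup>2" using d(1,2)[OF r0] by (intro power_mono) auto
      finally show ?thesis by (rule drift) (rule True)
    next
      case False
      then have "d r = 0" by (intro d(3)) simp
      then have "dir_deriv n p V x0 = 0" by (simp add: p_def dir_deriv_def)
      then show ?thesis using K0 by simp
    qed
    then show ?thesis using main Vzz Vuu Qsum qzz lM unfolding Wzz by linarith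
  qed
  from quadratic_inequality_bound[OF l L K0 M this]
  have "M * exp (\<Psi> r) \<le> (1 + 2 * (L + ?K) / l) * exp (lq * ?P\<^sup>2)"
    using M d(7)[OF r0] by (intro mult_mono) auto
  then show ?thesis unfolding h0 pogorelov_bound_def .
qed

theorem proposition4p3:
  fixes R P' l L lq :: real
  assumes "R > 0" and "l > 0" and "L > 0" and "lq \<ge> 0" and "P' > 0"
    and "theta_well_defined R l lq"
  shows "\<exists>C>0. \<forall>(n::nat) (V :: (nat \<Rightarrow> real) \<Rightarrow> real) (q :: (nat \<Rightarrow> real) \<Rightarrow> real) (c_q :: real)
      (c_qj :: ereal \<Rightarrow> real) (\<phi> :: ereal \<Rightarrow> (nat \<Rightarrow> real) \<Rightarrow> real) (j' :: real).
    n \<ge> 1 \<longrightarrow>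
    smooth_Rn n V \<longrightarrow>
    has_prob_density n (\<lambda>x. exp (- V x)) \<longrightarrow>
    (\<forall>x\<in>Rn n. V (origin_Rn n) \<le> V x) \<longrightarrow>
    hessian_ge n l V \<longrightarrow>
    hessian_le n L V \<longrightarrow>
    smooth_compact_support_in n (ball_Rn n (ereal R)) q \<longrightarrow>
    hessian_ge n (- lq) q \<longrightarrow>
    has_prob_density n (\<lambda>x. exp (- V x + c_q - q x)) \<longrightarrow>
    (\<forall>j. ereal (const_P R l lq) < j \<longrightarrow>
       (if j = \<infinity> then c_qj j = 0 else c_qj j > 0) \<and>
       has_prob_density n (target_density n V q c_q (c_qj j) j) \<and>
       smooth_Rn n (\<phi> j) \<and>
       convex_fun_Rn n (\<phi> j) \<and>
       (\<forall>x\<in>Rn n. grad n (\<phi> j) x \<in> ball_Rn n j \<and>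
          Determinant.det (hessian n (\<phi> j) x) =
            exp (- V x) / target_density n V q c_q (c_qj j) j (grad n (\<phi> j) x))) \<longrightarrow>
    j' > 0 \<longrightarrow>
    (\<forall>j. ereal (const_P R l lq) < j \<and> ereal j' \<le> j \<longrightarrow>
       grad n (\<phi> j) ` (Rn n - ball_Rn n (ereal P')) \<subseteq> Rn n - ball_Rn n (ereal (const_P R l lq))) \<longrightarrow>
    (\<forall>j. ereal (const_P R l lq) < j \<and> ereal j' \<le> j \<longrightarrow>
       (\<forall>x0\<in>Rn n. \<forall>\<alpha>0\<in>sphere_Rn n.
          (\<forall>x\<in>Rn n. \<forall>\<alpha>\<in>sphere_Rn n. h_fun R l lq n (\<phi> j) x \<alpha> \<le> h_fun R l lq n (\<phi> j) x0 \<alpha>0) \<longrightarrow>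
          h_fun R l lq n (\<phi> j) x0 \<alpha>0 \<le> C))"
proof (rule exI[of _ "pogorelov_bound R P' l L lq"], intro conjI allI impI ballI)
  have "drift_bound R P' l L lq \<ge> 0" using assms(3) by (simp add: drift_bound_def)
  then show "pogorelov_bound R P' l L lq > 0"
    unfolding pogorelov_bound_def using assms by (intro mult_pos_pos add_pos_nonneg) auto
next
  fix n :: nat and V q :: "(nat \<Rightarrow> real) \<Rightarrow> real" and c_q :: real and c_qj :: "ereal \<Rightarrow> real"
    and \<phi> :: "ereal \<Rightarrow> (nat \<Rightarrow> real) \<Rightarrow> real" and j' :: real and j :: ereal and x0 \<alpha>0
  assume n: "n \<ge> 1" and V: "smooth_Rn n V" "\<forall>x\<in>Rn n. V (origin_Rn n) \<le> V x" "hessian_ge n l V" "hessian_le n L V"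
    and q: "smooth_compact_support_in n (ball_Rn n (ereal R)) q" "hessian_ge n (- lq) q"
    and \<phi>: "\<forall>j. ereal (const_P R l lq) < j \<longrightarrow>
       (if j = \<infinity> then c_qj j = 0 else c_qj j > 0) \<and>
       has_prob_density n (target_density n V q c_q (c_qj j) j) \<and>
       smooth_Rn n (\<phi> j) \<and>
       convex_fun_Rn n (\<phi> j) \<and>
       (\<forall>x\<in>Rn n. grad n (\<phi> j) x \<in> ball_Rn n j \<and>
          Determinant.det (hessian n (\<phi> j) x) =
            exp (- V x) / target_density n V q c_q (c_qj j) j (grad n (\<phi> j) x))"
    and loc: "\<forall>j. ereal (const_P R l lq) < j \<and> ereal j' \<le> j \<longrightarrow>
       grad n (\<phi> j) ` (Rn n - ball_Rn n (ereal P')) \<subseteq> Rn n - ball_Rn n (ereal (const_P R l lq))"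
    and j: "ereal (const_P R l lq) < j \<and> ereal j' \<le> j"
    and x0: "x0 \<in> Rn n" and \<alpha>0: "\<alpha>0 \<in> sphere_Rn n"
    and max: "\<forall>x\<in>Rn n. \<forall>\<alpha>\<in>sphere_Rn n. h_fun R l lq n (\<phi> j) x \<alpha> \<le> h_fun R l lq n (\<phi> j) x0 \<alpha>0"
  have \<phi>j: "smooth_Rn n (\<phi> j)" "convex_fun_Rn n (\<phi> j)"
    and range: "\<And>x. x \<in> Rn n \<Longrightarrow> grad n (\<phi> j) x \<in> ball_Rn n j"
    and MA: "\<And>x. x \<in> Rn n \<Longrightarrow> Determinant.det (hessian n (\<phi> j) x) =
            exp (- V x) / target_density n V q c_q (c_qj j) j (grad n (\<phi> j) x)"
    using \<phi> j by blast+
  show "h_fun R l lq n (\<phi> j) x0 \<alpha>0 \<le> pogorelov_bound R P' l L lq"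
  proof (rule hessian_bound_at_maximum[OF assms(1-4,6) V(1) _ V(3,4) q \<phi>j _ _ x0 \<alpha>0, where c = "c_qj j + c_q"])
    fix x assume x: "x \<in> Rn n"
    have "target_density n V q c_q (c_qj j) j y = exp (c_qj j - V y + c_q - q y)" if "y \<in> ball_Rn n j" for y
      using that by (simp add: target_density_def V_trunc_def exp_ereal_def)
    then show "Determinant.det (hessian n (\<phi> j) x) =
        exp (- V x + (V (grad n (\<phi> j) x) + q (grad n (\<phi> j) x)) - (c_qj j + c_q))"
      unfolding MA[OF x] using range[OF x] by (simp add: exp_diff[symmetric] algebra_simps)
    assume small: "norm_Rn n (grad n (\<phi> j) x) < const_P R l lq"
    show "norm_Rn n x \<le> P'"
    proof (rule ccontr)
      assume "\<not> norm_Rn n x \<le> P'"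
      then have "x \<in> Rn n - ball_Rn n (ereal P')" using x by (simp add: ball_Rn_def)
      then have "grad n (\<phi> j) x \<notin> ball_Rn n (ereal (const_P R l lq))" using loc j by blast
      with small show False by (simp add: ball_Rn_def grad_Rn)
    qed
  qed (use V(2) max n in auto)
qed

end
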